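(* Let $Q$ be a prime power, let $\alpha\in\mathbb{F}_{Q^2}^*$ and let $\beta\in\mathbb{F}_Q$. The polynomial $\alpha x^{2Q+3}+\beta x$ is a complete permutation polynomial over $\mathbb{F}_{Q^2}$ if and only if one of the following holds (where $n$ denotes a positive integer): (1) $Q\equiv\pm 2\pmod{5}$ and $\alpha^{2Q-2}-3\alpha^{Q-1}+1=0$; (2) $Q=5^n$ and $\alpha^{Q-1}=-1$; (3) $Q=5^n$ and both $\beta^{(Q-1)/2}$ and $(\beta+1)^{(Q-1)/2}$ lie in $\{0,-\alpha^{(Q-1)/2}\}$; (4) $Q=13$ and $\alpha^{12}-3\alpha^6+1=0$ and $\beta\in\{0,3,-4,-1\}$; (5) $Q=13$ and $\alpha^{12}+3\alpha^6+1=0$ and $\beta\in\{5,6,7\}$; (6) $Q=5$ and $\alpha^4-\alpha^2+1=0$ and $\beta\in\{0,-1\}$; (7) $Q=5$ and $\alpha^4+\alpha^2+1=0$ and $\beta=2$; (8) $Q=3$ and $\alpha^2=-1$; or (9) $Q=3$ and $\alpha+\beta=1$.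
   Context: For a prime power $Q$, $\mathbb{F}_Q$ denotes the finite field with $Q$ elements, regarded as a subfield of $\mathbb{F}_{Q^2}$, and $\mathbb{F}_{Q^2}^*$ is the set of nonzero elements of $\mathbb{F}_{Q^2}$. A polynomial is a permutation polynomial over a finite field $\mathbb{F}$ if it induces a bijection from $\mathbb{F}$ to itself. A complete permutation polynomial over $\mathbb{F}_q$ is a polynomial $f(x)\in\mathbb{F}_q[x]$ such that both $f(x)$ and $f(x)+x$ are permutation polynomials over $\mathbb{F}_q$. *)

theory Defs
  imports
    "HOL-Computational_Algebra.Computational_Algebra"
    "HOL-Number_Theory.Cong"
    "HOL-Number_Theory.Prime_Powers"
begin

definition is_subfield :: "'a::field set \<Rightarrow> bool" where
  "is_subfield K \<longleftrightarrow>
     0 \<in> K \<and> 1 \<in> K \<and>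
     (\<forall>x\<in>K. \<forall>y\<in>K. x + y \<in> K) \<and>
     (\<forall>x\<in>K. \<forall>y\<in>K. x * y \<in> K) \<and>
     (\<forall>x\<in>K. - x \<in> K) \<and>
     (\<forall>x\<in>K. inverse x \<in> K)"

definition permutation_poly :: "'a::finite_field poly \<Rightarrow> bool" where
  "permutation_poly f \<longleftrightarrow> bij (poly f)"

definition complete_permutation_poly :: "'a::finite_field poly \<Rightarrow> bool" where
  "complete_permutation_poly f \<longleftrightarrow> permutation_poly f \<and> permutation_poly (f + [:0, 1:])"

end

theory Submission
  imports Defs
begin

text \<open>
  Let \<open>N\<close> and \<open>T\<close> be the norm and the trace of \<open>\<alpha>\<close> over the subfield \<open>K\<close> with \<open>q\<close> elements.
  Since \<open>\<alpha> x\<^sup>2\<^sup>q\<^sup>+\<^sup>3 + \<beta> x = x (\<alpha> n\<^sup>2 + \<beta>)\<close> with \<open>n = x\<^sup>q\<^sup>+\<^sup>1 \<in> K\<close>, taking norms shows that this polynomial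
  permutes the big field iff \<open>g(y) = N y\<^sup>5 + T \<beta> y\<^sup>3 + \<beta>\<^sup>2 y\<close> permutes \<open>K\<close>. For \<open>\<beta> \<noteq> 0\<close> this leads to
  odd permutation quintics \<open>y\<^sup>5 + a y\<^sup>3 + b y\<close> with \<open>b \<noteq> 0\<close>. Away from characteristic 5, Hermite's
  criterion for one or two exponents \<open>k\<close> with \<open>5 k = q + r\<close>, \<open>r\<close> small, forces \<open>a\<^sup>2 = 5 b\<close> apart from
  the fields with 2, 3, 9 and 13 elements. In characteristic 5, injectivity means that a certain
  quartic in \<open>h\<close> takes only nonsquare values for \<open>h \<noteq> 0\<close>, and comparing two pairs of coefficients of its
  \<open>(q - 1) / 2\<close>-th power gives \<open>a\<^sup>2 = 4 b\<close> unless \<open>a = 0\<close>.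
  Conversely, \<open>a\<^sup>2 = 5 b\<close> makes \<open>(g(y) - g(z)) / (y - z)\<close> a norm from \<open>K(\<surd>5)\<close>, and here \<open>\<surd>5 \<notin> K\<close>
  because \<open>u = \<alpha>\<^sup>q\<^sup>-\<^sup>1\<close> satisfies \<open>u\<^sup>2 - 3 u + 1 = 0\<close>.
\<close>

section \<open>Subfields of a finite field\<close>

text \<open>The hard direction is the necessity of a^2 = 5b. With 5k = q + r and r + 2 < q,
  Hermite's criterion says that a single coefficient of (1 + a z + b z^2)^k vanishes, the one of
  z^((r+1)/2); since q = 0 in the field, it is formally the coefficient of the power with exponent
  r/5. For q = 2 mod 5, r = 3 gives 3 (5b - a^2) / 25. For q = 3 mod 5, r = 7 gives 7 (a^2 - 5b)
  (2a^2 - 5b) / 625, and r = 17 is used to remove the second factor. For q = 13 the bound r + 2 < q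
  rules out r = 17, and this is the origin of the sporadic cases over that field. The obstacle is
  small characteristic, where the constants 3, 7, 11, 17 or the denominators n! vanish. There k is
  replaced by a fixed k0 congruent to it modulo a power of the characteristic, and often other
  values of r are needed. Completeness concerns \<beta> and \<beta> + 1, one of which is nonzero. In
  most fields a nonzero parameter already forces a condition on \<alpha> alone, which then serves
  both; the interplay of the two parameters matters only for q = 3, q = 13 and in characteristic
  5.\<close>

locale finite_subfield =
  fixes K :: "'a::finite_field set" and q :: nat
  assumes subfield: "is_subfield K" and card_K: "card K = q"
begin

lemma zero_mem [simp]: "0 \<in> K" and one_mem [simp]: "1 \<in> K"
  using subfield by (auto simp: is_subfield_def)

lemma add_mem [simp]: "x \<in> K \<Longrightarrow> y \<in> K \<Longrightarrow> x + y \<in> K"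
  and mult_mem [simp]: "x \<in> K \<Longrightarrow> y \<in> K \<Longrightarrow> x * y \<in> K"
  and uminus_mem [simp]: "x \<in> K \<Longrightarrow> - x \<in> K"
  and inverse_mem [simp]: "x \<in> K \<Longrightarrow> inverse x \<in> K"
  using subfield by (auto simp: is_subfield_def)

lemma diff_mem [simp]: "x \<in> K \<Longrightarrow> y \<in> K \<Longrightarrow> x - y \<in> K"
  using add_mem[of x "- y"] by simp

lemma divide_mem [simp]: "x \<in> K \<Longrightarrow> y \<in> K \<Longrightarrow> x / y \<in> K"
  by (simp add: divide_inverse)

lemma power_mem [simp]: "x \<in> K \<Longrightarrow> x ^ n \<in> K"
  by (induction n) auto

lemma of_nat_mem [simp]: "of_nat n \<in> K"
  by (induction n) auto

lemma numeral_mem [simp]: "numeral n \<in> K"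
  using of_nat_mem[of "numeral n"] by simp

lemma q_ge_2: "q \<ge> 2"
  using card_mono[of K "{0, 1}"] card_K by simp

lemma card_units: "card (K - {0}) = q - 1"
  by (simp add: card_K)

lemma power_units: "x ^ (q - 1) = 1" if "x \<in> K" "x \<noteq> 0"
proof -
  have "(\<Prod>y\<in>K-{0}. x * y) = x ^ (q - 1) * \<Prod>(K-{0})"
    by (simp add: prod.distrib card_units)
  moreover have "(\<Prod>y\<in>K-{0}. x * y) = \<Prod>(K-{0})"
    by (rule prod.reindex_bij_witness[of _ "\<lambda>y. y / x" "\<lambda>y. x * y"]) (use that in auto)
  ultimately show ?thesis
    by simp
qed

lemma power_q: "x ^ q = x" if "x \<in> K"
proof (cases "x = 0")
  case False
  have "x ^ q = x ^ (q - 1) * x"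
    using q_ge_2 by (metis Suc_diff_1 less_le_trans pos2 power_Suc2)
  then show ?thesis
    using power_units[OF that False] by simp
qed (use q_ge_2 in auto)

lemma card_power_eq_one: "card {x::'a. x ^ n = 1} \<le> n" if "n > 0"
proof -
  have deg: "degree (Polynomial.monom 1 n - 1 :: 'a poly) \<le> n"
    by (intro degree_diff_le) (auto simp: degree_monom_le)
  have "Polynomial.coeff (Polynomial.monom 1 n - 1 :: 'a poly) n = 1"
    using that by simp
  then have "(Polynomial.monom 1 n - 1 :: 'a poly) \<noteq> 0"
    by (metis coeff_0 zero_neq_one)
  then have "card {x. poly (Polynomial.monom 1 n - 1 :: 'a poly) x = 0} \<le> n"
    using card_poly_roots_bound deg le_trans by blast
  then show ?thesis
    by (simp add: poly_monom)
qed

text \<open>All q elements of \<open>K\<close> are roots of X^q - X, which has at most q roots in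
  the big field, so the two sets agree.\<close>

lemma mem_iff: "x \<in> K \<longleftrightarrow> x ^ q = x"
proof -
  have "{x. x ^ q = x} \<subseteq> insert 0 {x::'a. x ^ (q - 1) = 1}"
  proof
    fix x :: 'a assume "x \<in> {x. x ^ q = x}"
    moreover have "x ^ q = x ^ (q - 1) * x"
      using q_ge_2 by (metis Suc_diff_1 less_le_trans pos2 power_Suc2)
    ultimately show "x \<in> insert 0 {x. x ^ (q - 1) = 1}"
      by (metis (mono_tags) insert_iff mem_Collect_eq mult_cancel_right1)
  qed
  then have "card {x::'a. x ^ q = x} \<le> card (insert 0 {x::'a. x ^ (q - 1) = 1})"
    by (intro card_mono) auto
  also have "\<dots> \<le> Suc (card {x::'a. x ^ (q - 1) = 1})"
    by (rule card_insert_le_m1) auto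
  also have "\<dots> \<le> q"
    using card_power_eq_one[of "q - 1"] q_ge_2 by auto
  finally have "card {x::'a. x ^ q = x} \<le> card K"
    by (simp add: card_K)
  then have "K = {x. x ^ q = x}"
    using power_q by (intro card_seteq) auto
  then show ?thesis
    by blast
qed

text \<open>A count that needs no generator: the fibres of the d-th power map have at most d
  elements, so its image has at least (q - 1) / d elements, and all of them lie among the at most (q
  - 1) / d solutions of x^((q-1)/d) = 1.\<close>

lemma ex_root:
  assumes "d dvd q - 1" "x \<in> K" "x \<noteq> 0" "x ^ ((q - 1) div d) = 1"
  obtains y where "y \<in> K" "y \<noteq> 0" "y ^ d = x"
proof -
  define e where "e = (q - 1) div d"
  have de: "d * e = q - 1"
    using assms(1) by (simp add: e_def)
  have pos: "d > 0" "e > 0"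
    using de q_ge_2 by (auto intro!: Nat.gr0I)
  let ?I = "(\<lambda>y. y ^ d) ` (K - {0})"
  have sub: "?I \<subseteq> {x \<in> K - {0}. x ^ e = 1}"
    using power_units by (auto simp: de simp flip: power_mult)
  have fib: "card {y \<in> K - {0}. y ^ d = z} \<le> d" if z: "z \<in> ?I" for z
  proof -
    obtain w where w: "w \<in> K" "w \<noteq> 0" "z = w ^ d"
      using z by auto
    have "(\<lambda>y. y / w) ` {y \<in> K - {0}. y ^ d = z} \<subseteq> {x. x ^ d = 1}"
      using w by (auto simp: power_divide)
    then have "card ((\<lambda>y. y / w) ` {y \<in> K - {0}. y ^ d = z}) \<le> d"
      using card_power_eq_one[OF pos(1)] card_mono[of "{x::'a. x ^ d = 1}"] by (meson finite le_trans)
    then show ?thesis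
      using w by (subst (asm) card_image) (auto simp: inj_on_def)
  qed
  have "q - 1 = (\<Sum>z\<in>?I. card {y \<in> K - {0}. y ^ d = z})"
    by (subst card_units[symmetric], subst card_eq_sum, subst sum.image_gen[of _ _ "\<lambda>y. y ^ d"]) auto
  also have "\<dots> \<le> (\<Sum>z\<in>?I. d)"
    by (intro sum_mono fib)
  finally have "d * e \<le> d * card ?I"
    by (simp add: de mult.commute)
  then have "e \<le> card ?I"
    using pos by simp
  moreover have "card {x \<in> K - {0}. x ^ e = 1} \<le> e"
    using card_power_eq_one[OF pos(2)] card_mono[of "{x::'a. x ^ e = 1}" "{x \<in> K - {0}. x ^ e = 1}"]
    by (auto intro: le_trans)
  ultimately have "?I = {x \<in> K - {0}. x ^ e = 1}"
    using sub by (intro card_seteq) auto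
  moreover have "x \<in> {x \<in> K - {0}. x ^ e = 1}"
    using assms by (auto simp: e_def)
  ultimately have "x \<in> ?I"
    by blast
  then show ?thesis
    using that by auto
qed

text \<open>Translation by 1 permutes \<open>K\<close>, yet it changes the sum over \<open>K\<close>
  by q.\<close>

lemma of_nat_q [simp]: "of_nat q = (0 :: 'a)"
proof -
  have "(\<Sum>x\<in>K. x + 1) = (\<Sum>x\<in>K. x)"
    by (rule sum.reindex_bij_witness[of _ "\<lambda>x. x - 1" "\<lambda>x. x + 1"]) auto
  then show ?thesis
    by (simp add: sum.distrib card_K)
qed

text \<open>If q - 1 does not divide j, some unit g has g^j different from 1, because x^i = 1 has at
  most i < q - 1 solutions for i = j mod (q - 1); scaling by g multiplies the sum by g^j and also
  preserves it.\<close>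

lemma sum_power_units:
  "(\<Sum>x\<in>K-{0}. x ^ j) = (if (q - 1) dvd j then - 1 else 0)"
proof (cases "(q - 1) dvd j")
  case True
  then have "(\<Sum>x\<in>K-{0}. x ^ j) = (\<Sum>x\<in>K-{0}. 1)"
    using power_units by (intro sum.cong) (auto simp: power_mult elim!: dvdE)
  also have "\<dots> = of_nat (q - 1)"
    by (simp add: card_units)
  also have "\<dots> = -1"
    using q_ge_2 by (simp add: of_nat_diff)
  finally show ?thesis
    using True by simp
next
  case False
  define i where "i = j mod (q - 1)"
  have i: "0 < i" "i < q - 1"
    using False q_ge_2 by (auto simp: i_def mod_greater_zero_iff_not_dvd)
  have "\<not> K - {0} \<subseteq> {x. x ^ i = 1}"
  proof
    assume "K - {0} \<subseteq> {x. x ^ i = 1}"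
    then have "card (K - {0}) \<le> card {x::'a. x ^ i = 1}"
      by (intro card_mono) auto
    then show False
      using card_power_eq_one[OF i(1)] i by (simp add: card_units)
  qed
  then obtain g where g: "g \<in> K" "g \<noteq> 0" "g ^ i \<noteq> 1"
    by auto
  have "g ^ j = g ^ ((q - 1) * (j div (q - 1)) + i)"
    by (simp add: i_def)
  also have "\<dots> = g ^ i"
    using power_units[OF g(1,2)] by (simp add: power_add power_mult)
  finally have gj: "g ^ j \<noteq> 1"
    using g by simp
  have "(\<Sum>x\<in>K-{0}. x ^ j) = (\<Sum>x\<in>K-{0}. (g * x) ^ j)"
    by (rule sum.reindex_bij_witness[of _ "\<lambda>y. g * y" "\<lambda>y. y / g"]) (use g in auto)
  also have "\<dots> = g ^ j * (\<Sum>x\<in>K-{0}. x ^ j)"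
    by (simp add: power_mult_distrib sum_distrib_left)
  finally have "(\<Sum>x\<in>K-{0}. x ^ j) = 0"
    using gj by simp
  with False show ?thesis
    by simp
qed

end

section \<open>Powers of trinomials and Hermite's criterion\<close>

lemma binomial_prime_power_dvd:
  assumes "prime (p::nat)" "0 < j" "j < p ^ s"
  shows "p dvd ((p ^ s * t) choose j)"
proof (rule ccontr)
  assume "\<not> p dvd ((p ^ s * t) choose j)"
  then have cop: "coprime (p ^ s) ((p ^ s * t) choose j)"
    using assms(1) by (simp add: prime_imp_coprime)
  have "j * ((p ^ s * t) choose j) = p ^ s * t * ((p ^ s * t - 1) choose (j - 1))"
    using assms(2) by (rule times_binomial_minus1_eq)
  then have "p ^ s dvd j * ((p ^ s * t) choose j)"
    by (metis dvd_triv_left mult.assoc)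
  then have "p ^ s dvd j"
    using cop by (simp add: coprime_dvd_mult_left_iff)
  then show False
    using assms by (auto dest: dvd_imp_le)
qed

text \<open>In Vandermonde's convolution for k = k0 + p^s t, every term but the last has a factor
  (p^s t choose j) with 0 < j < p^s, which p divides.\<close>

lemma of_nat_binomial_cong:
  assumes "prime CHAR('a::comm_ring_1)" "k mod (CHAR('a) ^ s) = k0 mod (CHAR('a) ^ s)"
    "k0 \<le> k" "n < CHAR('a) ^ s"
  shows "of_nat (k choose n) = (of_nat (k0 choose n) :: 'a)"
proof -
  define P where "P = CHAR('a) ^ s"
  obtain t where t: "k = k0 + P * t"
    using assms(2,3) by (metis P_def mod_eq_nat1E mod_eq_nat2E)
  have "of_nat (k choose n) = (\<Sum>i\<le>n. of_nat (k0 choose i) * of_nat ((P * t) choose (n - i)) :: 'a)"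
    unfolding t vandermonde[symmetric] by simp
  also have "\<dots> = (\<Sum>i\<in>{n}. of_nat (k0 choose i) * of_nat ((P * t) choose (n - i)))"
  proof (intro sum.mono_neutral_right ballI)
    fix i assume "i \<in> {..n} - {n}"
    then have "CHAR('a) dvd ((P * t) choose (n - i))"
      unfolding P_def using assms by (intro binomial_prime_power_dvd) auto
    then have "of_nat ((P * t) choose (n - i)) = (0::'a)"
      by (simp only: of_nat_eq_0_iff_char_dvd)
    then show "of_nat (k0 choose i) * of_nat ((P * t) choose (n - i)) = (0::'a)"
      by simp
  qed auto
  finally show ?thesis
    by simp
qed

text \<open>Two binomial expansions of 1 + z (a + b z), with n the number of factors that contribute
  z (a + b z). The truncated exponent 2n - w is harmless: for 2n < w the second binomial coefficient
  is 0.\<close>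

lemma coeff_trinomial_power:
  fixes a b :: "'a::comm_ring_1"
  shows "Polynomial.coeff ([:1, a, b:] ^ k) w =
    (\<Sum>n\<le>w. of_nat (k choose n) * of_nat (n choose (w - n)) * a ^ (2 * n - w) * b ^ (w - n))"
proof -
  have eq: "[:1, a, b:] = Polynomial.monom 1 1 * [:a, b:] + 1"
    by (simp add: monom_altdef one_pCons)
  have lin: "Polynomial.coeff ([:a, b:] ^ n) i = of_nat (n choose i) * b ^ i * a ^ (n - i)" for n i
  proof -
    have "[:a, b:] ^ n = (Polynomial.monom b 1 + [:a:]) ^ n"
      by (simp add: monom_altdef)
    also have "\<dots> = (\<Sum>i\<le>n. Polynomial.monom (of_nat (n choose i) * b ^ i * a ^ (n - i)) i)"
      by (simp add: binomial_ring monom_power of_nat_poly smult_monom poly_const_pow mult_ac)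
    finally show ?thesis
      by (simp add: coeff_sum sum.delta binomial_eq_0)
  qed
  have exp: "(Polynomial.monom 1 1 * L + 1) ^ k = (\<Sum>n\<le>k. Polynomial.monom (of_nat (k choose n)) n * L ^ n)"
    for L :: "'a poly"
    by (simp add: binomial_ring power_mult_distrib monom_power of_nat_poly mult.assoc smult_monom flip: mult_smult_left)
  have "Polynomial.coeff ([:1, a, b:] ^ k) w =
    (\<Sum>n\<le>k. of_nat (k choose n) * (if w < n then 0 else Polynomial.coeff ([:a, b:] ^ n) (w - n)))"
    unfolding eq exp by (auto simp: coeff_sum coeff_monom_mult intro!: sum.cong)
  also have "\<dots> = (\<Sum>n\<in>{..k} \<inter> {..w}. of_nat (k choose n) * Polynomial.coeff ([:a, b:] ^ n) (w - n))"
    by (intro sum.mono_neutral_cong_right) auto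
  also have "\<dots> = (\<Sum>n\<le>w. of_nat (k choose n) * Polynomial.coeff ([:a, b:] ^ n) (w - n))"
    by (intro sum.mono_neutral_left ballI) (auto simp: binomial_eq_0)
  finally show ?thesis
    unfolding lin by (simp add: mult_2 mult.assoc mult.left_commute mult.commute[of "b ^ _"])
qed

lemma coeff_trinomial_power_cong:
  fixes a b :: "'a::comm_ring_1"
  assumes "prime CHAR('a)" "k mod (CHAR('a) ^ s) = k0 mod (CHAR('a) ^ s)"
    "k0 \<le> k" "w < CHAR('a) ^ s"
  shows "Polynomial.coeff ([:1, a, b:] ^ k) w = Polynomial.coeff ([:1, a, b:] ^ k0) w"
  unfolding coeff_trinomial_power
  by (intro sum.cong refl) (use of_nat_binomial_cong[OF assms(1-3)] assms(4) in simp)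

context finite_subfield
begin

text \<open>Hermite's criterion: the k-th powers of the values sum to the k-th powers of the
  arguments, hence to 0. After expansion only exponents divisible by q - 1 survive; they are
  positive because w is at most 2k.\<close>

lemma sum_quintic_power:
  fixes a b :: 'a
  assumes "bij_betw f K K" "0 < k" "\<not> (q - 1) dvd k"
    and f: "\<And>y. f y = y ^ 5 + a * y ^ 3 + b * y"
  shows "(\<Sum>w | w \<le> 2 * k \<and> (q - 1) dvd (5 * k - 2 * w). Polynomial.coeff ([:1, a, b:] ^ k) w) = 0"
proof -
  let ?c = "Polynomial.coeff ([:1, a, b:] ^ k)"
  have expand: "f y ^ k = (\<Sum>w\<le>2 * k. ?c w * y ^ (5 * k - 2 * w))" if "y \<noteq> 0" for y
  proof -
    \<comment> \<open>Reversing the quintic puts its leading coefficient at index 0, so that the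
      coefficients needed later have small index.\<close>
    have "f y = y ^ 5 * poly [:1, a, b:] (inverse y ^ 2)"
      using that unfolding f by (simp add: field_simps power2_eq_square eval_nat_numeral)
    then have "f y ^ k = y ^ (5 * k) * poly ([:1, a, b:] ^ k) (inverse y ^ 2)"
      by (simp add: power_mult_distrib poly_power flip: power_mult)
    also have "degree ([:1, a, b:] ^ k) \<le> 2 * k"
      by (rule order.trans[OF degree_power_le]) (auto simp: degree_pCons_le)
    then have "poly ([:1, a, b:] ^ k) (inverse y ^ 2) = (\<Sum>w\<le>2 * k. ?c w * (inverse y ^ 2) ^ w)"
      unfolding poly_altdef by (intro sum.mono_neutral_left) (auto simp: coeff_eq_0)
    also have "y ^ (5 * k) * \<dots> = (\<Sum>w\<le>2 * k. ?c w * (y ^ (5 * k) * (inverse y ^ 2) ^ w))"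
      by (simp add: sum_distrib_left mult_ac)
    also have "\<dots> = (\<Sum>w\<le>2 * k. ?c w * y ^ (5 * k - 2 * w))"
      using that by (intro sum.cong refl) (simp add: power_diff power_inverse field_simps flip: power_mult)
    finally show ?thesis .
  qed
  have "0 = (\<Sum>y\<in>K. y ^ k)"
    using sum_power_units[of k] assms(2,3) by (simp add: sum.remove[of K 0])
  also have "\<dots> = (\<Sum>y\<in>K. f y ^ k)"
    by (rule sum.reindex_bij_betw[OF assms(1), symmetric])
  also have "\<dots> = (\<Sum>y\<in>K-{0}. f y ^ k)"
    using assms(2) by (simp add: sum.remove[of K 0] f)
  also have "\<dots> = (\<Sum>y\<in>K-{0}. \<Sum>w\<le>2 * k. ?c w * y ^ (5 * k - 2 * w))"
    using expand by (intro sum.cong) auto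
  also have "\<dots> = (\<Sum>w\<le>2 * k. ?c w * (\<Sum>y\<in>K-{0}. y ^ (5 * k - 2 * w)))"
    by (subst sum.swap) (simp add: sum_distrib_left)
  also have "\<dots> = (\<Sum>w | w \<le> 2 * k \<and> (q - 1) dvd (5 * k - 2 * w). - ?c w)"
    unfolding sum_power_units by (intro sum.mono_neutral_cong_right) auto
  finally show ?thesis
    by (simp add: sum_negf)
qed

end

section \<open>Odd permutation quintics\<close>

lemma numeral_eq_0_iff_CHAR: "(numeral n :: 'a::semiring_1) = 0 \<longleftrightarrow> CHAR('a) dvd numeral n"
  by (metis of_nat_eq_0_iff_char_dvd of_nat_numeral)

text \<open>The difference k - n is formed in the ring, without truncation, so that 5k can be
  replaced by r afterwards.\<close>

lemma of_nat_binomial_Suc: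
  "of_nat (Suc n) * of_nat (k choose Suc n) = (of_nat k - of_nat n) * (of_nat (k choose n) :: 'a::comm_ring_1)"
proof (cases "n \<le> k")
  case True
  have "Suc n * (k choose Suc n) = (k - n) * (k choose n)"
    using times_binomial_minus1_eq[of "Suc n" k] by (simp only: binomial_absorb_comp diff_Suc_1 zero_less_Suc)
  then have "of_nat (Suc n * (k choose Suc n)) = (of_nat ((k - n) * (k choose n)) :: 'a)"
    by simp
  then show ?thesis
    using True by (simp only: of_nat_mult of_nat_diff)
qed (simp add: binomial_eq_0)

text \<open>The quintic g of the overview made monic; b stands for \<beta>^2 / N, so it is nonzero
  exactly when \<beta> is.\<close>

locale permuting_quintic = finite_subfield K q for K :: "'a::finite_field set" and q +
  fixes a b :: 'a
  assumes q_power: "\<exists>n. q = CHAR('a) ^ n"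
    and a_mem: "a \<in> K" and b_mem: "b \<in> K" and b_nz: "b \<noteq> 0"
    and bij: "bij_betw (\<lambda>y. y ^ 5 + a * y ^ 3 + b * y) K K"
begin

lemma hermite_sum:
  assumes "0 < k" "\<not> (q - 1) dvd k"
  shows "(\<Sum>w | w \<le> 2 * k \<and> (q - 1) dvd (5 * k - 2 * w). Polynomial.coeff ([:1, a, b:] ^ k) w) = 0"
  using sum_quintic_power[OF bij assms refl] .

text \<open>The exponents 5k - 2v lie between k > 0 and q + r < 2 (q - 1), so q - 1 itself is the
  only multiple of q - 1 among them.\<close>

lemma hermite_coeff:
  assumes "5 * k = q + r" "r + 2 < q" "r + 1 = 2 * w"
  shows "Polynomial.coeff ([:1, a, b:] ^ k) w = 0"
proof -
  have "{v. v \<le> 2 * k \<and> (q - 1) dvd (5 * k - 2 * v)} = {w}" (is "?L = _")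
  proof (intro equalityI subsetI)
    fix v assume "v \<in> ?L"
    then obtain c where c: "v \<le> 2 * k" "5 * k - 2 * v = (q - 1) * c"
      by (auto elim!: dvdE)
    have "(q - 1) * c < (q - 1) * 2" "(q - 1) * c \<noteq> 0"
      using c assms by linarith+
    then have "c = 1"
      using nat_mult_less_cancel1 by fastforce
    then show "v \<in> {w}"
      using c assms by auto
  next
    fix v assume "v \<in> {w}"
    moreover have "5 * k - 2 * w = q - 1"
      using assms by linarith
    ultimately show "v \<in> ?L"
      using assms by simp
  qed
  moreover have "\<not> (q - 1) dvd k" "0 < k"
    using assms by (auto dest: dvd_imp_le)
  ultimately show ?thesis
    using hermite_sum[of k] by simp
qed

text \<open>For 5k = q - 1 only the leading term of the k-th power has a large enough exponent, and
  its coefficient is 1.\<close>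

lemma q_mod_5_neq_1: "q mod 5 \<noteq> 1"
proof
  assume "q mod 5 = 1"
  define k where "k = (q - 1) div 5"
  have k: "5 * k = q - 1" "0 < k"
    using \<open>q mod 5 = 1\<close> q_ge_2 by (auto simp: k_def) presburger+
  have "{v. v \<le> 2 * k \<and> (q - 1) dvd (5 * k - 2 * v)} = {0}" (is "?L = _")
  proof (intro equalityI subsetI)
    fix v assume "v \<in> ?L"
    then show "v \<in> {0}"
      using k by (auto dest!: dvd_imp_le)
  qed (use k in auto)
  moreover have "\<not> (q - 1) dvd k"
    using k by (auto dest!: dvd_imp_le)
  ultimately have "Polynomial.coeff ([:1, a, b:] ^ k) 0 = 0"
    using hermite_sum[of k] k by simp
  then show False
    by (simp add: coeff_0_power)
qed

lemma five_k: "5 * of_nat k = (of_nat r :: 'a)" if "5 * k = q + r"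
proof -
  have "of_nat (5 * k) = (of_nat (q + r) :: 'a)"
    using that by simp
  then show ?thesis
    by simp
qed

lemma binomial_step:
  assumes "5 * k = q + r"
  shows "5 * of_nat (Suc n) * of_nat (k choose Suc n) = (of_nat r - 5 * of_nat n) * (of_nat (k choose n) :: 'a)"
proof -
  have "5 * of_nat (Suc n) * of_nat (k choose Suc n) = 5 * ((of_nat k - of_nat n) * (of_nat (k choose n) :: 'a))"
    by (simp only: of_nat_binomial_Suc mult.assoc)
  also have "\<dots> = (5 * of_nat k - 5 * of_nat n) * of_nat (k choose n)"
    by (simp add: algebra_simps)
  finally show ?thesis
    by (simp only: five_k[OF assms])
qed

text \<open>
  Formally \<open>k\<close> is \<open>r / 5\<close> in the field. This step computes \<open>5\<^sup>i (k choose n)\<close> successively, where \<open>e\<close> is the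
  part of \<open>5 (n + 1)\<close> that has to be cancelled.
\<close>
lemma binomial_scaled_step:
  assumes "5 * k = q + r" "A * of_nat (k choose n) = (c :: 'a)"
    and "e \<noteq> 0" "5 * of_nat (Suc n) = e * f" "(of_nat r - 5 * of_nat n) * c = e * c'" "m = Suc n"
  shows "A * f * of_nat (k choose m) = c'"
proof -
  have "e * (A * f * of_nat (k choose m)) = A * (e * f * of_nat (k choose m))"
    by (simp add: mult_ac)
  also have "\<dots> = A * ((of_nat r - 5 * of_nat n) * of_nat (k choose n))"
    using binomial_step[OF assms(1), of n] by (simp only: assms(4)[symmetric] assms(6))
  also have "\<dots> = (of_nat r - 5 * of_nat n) * c"
    by (simp only: assms(2)[symmetric] mult_ac)
  finally show ?thesis
    using assms(3,5) by simp
qed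

lemma char_dvd_q: "CHAR('a) ^ s dvd q \<or> (\<exists>i<s. q = CHAR('a) ^ i)"
  using q_power by (metis le_imp_power_dvd not_le)

text \<open>This is how small characteristics are treated: k0 solves 5 k0 = r modulo p^s, and
  indices below p^s cannot distinguish k from k0, so the coefficient becomes an explicit polynomial
  in a and b.\<close>

lemma coeff_cong:
  assumes "5 * k = q + r" "CHAR('a) ^ s dvd q" "5 * k0 mod CHAR('a) ^ s = r mod CHAR('a) ^ s"
    "coprime 5 CHAR('a)" "k0 \<le> k" "w < CHAR('a) ^ s"
  shows "Polynomial.coeff ([:1, a, b:] ^ k) w = Polynomial.coeff ([:1, a, b:] ^ k0) w"
proof (rule coeff_trinomial_power_cong)
  have "[5 * k = 5 * k0] (mod CHAR('a) ^ s)"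
    using assms(1-3) by (auto simp: cong_def elim!: dvdE)
  then have "[k = k0] (mod CHAR('a) ^ s)"
    using assms(4) by (subst (asm) cong_mult_lcancel_nat) (auto simp: coprime_power_right_iff)
  then show "k mod CHAR('a) ^ s = k0 mod CHAR('a) ^ s"
    by (simp add: cong_def)
qed (use assms in auto)

end

section \<open>Explicit coefficients of powers of a trinomial, and Lucas's theorem\<close>

lemma coeff_trinomial_power_1:
  "Polynomial.coeff ([:1, a, b:] ^ k) 1 = of_nat k * (a::'a::comm_ring_1)"
  by (simp add: coeff_trinomial_power)

lemma coeff_trinomial_power_2:
  "Polynomial.coeff ([:1, a, b:] ^ k) 2 = of_nat k * b + of_nat (k choose 2) * (a::'a::comm_ring_1)\<^sup>2"
  by (simp add: coeff_trinomial_power eval_nat_numeral)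

lemma coeff_trinomial_power_4:
  "Polynomial.coeff ([:1, a, b:] ^ k) 4 =
     of_nat (k choose 2) * b\<^sup>2 + 3 * of_nat (k choose 3) * a\<^sup>2 * b + of_nat (k choose 4) * (a::'a::comm_ring_1) ^ 4"
  by (simp add: coeff_trinomial_power eval_nat_numeral)

lemma coeff_trinomial_power_7:
  "Polynomial.coeff ([:1, a, b:] ^ k) 7 =
     4 * of_nat (k choose 4) * a * b ^ 3 + 10 * of_nat (k choose 5) * a ^ 3 * b\<^sup>2
     + 6 * of_nat (k choose 6) * a ^ 5 * b + of_nat (k choose 7) * (a::'a::comm_ring_1) ^ 7"
  by (simp add: coeff_trinomial_power eval_nat_numeral)

lemma coeff_trinomial_power_9:
  "Polynomial.coeff ([:1, a, b:] ^ k) 9 =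
     5 * of_nat (k choose 5) * a * b ^ 4 + 20 * of_nat (k choose 6) * a ^ 3 * b ^ 3
     + 21 * of_nat (k choose 7) * a ^ 5 * b\<^sup>2 + 8 * of_nat (k choose 8) * a ^ 7 * b
     + of_nat (k choose 9) * (a::'a::comm_ring_1) ^ 9"
  by (simp add: coeff_trinomial_power eval_nat_numeral)

lemma coeff_trinomial_power_19:
  "Polynomial.coeff ([:1, a, b:] ^ k) 19 =
     10 * of_nat (k choose 10) * a * b ^ 9 + 165 * of_nat (k choose 11) * a ^ 3 * b ^ 8
     + 792 * of_nat (k choose 12) * a ^ 5 * b ^ 7 + 1716 * of_nat (k choose 13) * a ^ 7 * b ^ 6
     + 2002 * of_nat (k choose 14) * a ^ 9 * b ^ 5 + 1365 * of_nat (k choose 15) * a ^ 11 * b ^ 4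
     + 560 * of_nat (k choose 16) * a ^ 13 * b ^ 3 + 136 * of_nat (k choose 17) * a ^ 15 * b\<^sup>2
     + 18 * of_nat (k choose 18) * a ^ 17 * b + of_nat (k choose 19) * (a::'a::comm_ring_1) ^ 19"
  by (simp add: coeff_trinomial_power eval_nat_numeral)

lemma coeff_trinomial_power_even:
  "Polynomial.coeff ([:1, 0, b:] ^ k) (2 * i) = of_nat (k choose i) * (b::'a::comm_ring_1) ^ i"
proof -
  have "Polynomial.coeff ([:1, 0, b:] ^ k) (2 * i) =
      (\<Sum>n\<in>{i}. of_nat (k choose n) * of_nat (n choose (2 * i - n)) * 0 ^ (2 * n - 2 * i) * b ^ (2 * i - n))"
    unfolding coeff_trinomial_power
    by (intro sum.mono_neutral_right ballI) (auto simp: power_0_left binomial_eq_0)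
  then show ?thesis
    by (simp add: mult_2)
qed

lemma numeral_neq_0_CHAR:
  assumes "prime (numeral r :: nat)" "CHAR('a) \<noteq> numeral r"
  shows "numeral r \<noteq> (0 :: 'a::idom_prime_char)"
  using assms primes_dvd_imp_eq[OF CHAR_prime assms(1)] by (auto simp: numeral_eq_0_iff_CHAR)

text \<open>One step of Lucas's theorem, by comparing coefficients in (X + 1)^k = (X^p + 1)^(k div
  p) (X + 1)^(k mod p). The last factor has degree below p, so only i = n div p contributes.\<close>

lemma of_nat_binomial_lucas:
  assumes "prime CHAR('a::comm_ring_1)"
  shows "of_nat (k choose n) = (of_nat ((k div CHAR('a)) choose (n div CHAR('a)))
    * of_nat ((k mod CHAR('a)) choose (n mod CHAR('a))) :: 'a)"
proof -
  define p where "p = CHAR('a)"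
  have "p > 0"
    using assms by (simp add: p_def prime_gt_0_nat)
  define X :: "'a poly" where "X = Polynomial.monom 1 1"
  have binom: "(X ^ e + 1) ^ m = (\<Sum>i\<le>m. Polynomial.monom (of_nat (m choose i)) (i * e))" for m e
    by (simp add: X_def binomial_ring monom_power of_nat_poly smult_monom mult.commute)
  have "(X + 1) ^ p = X ^ p + 1"
    using freshmans_dream[of p X 1] assms by (simp add: p_def)
  moreover have "(X + 1) ^ k = ((X + 1) ^ p) ^ (k div p) * (X + 1) ^ (k mod p)"
    by (simp flip: power_mult power_add)
  ultimately have "Polynomial.coeff ((X + 1) ^ k) n =
      Polynomial.coeff ((X ^ p + 1) ^ (k div p) * (X + 1) ^ (k mod p)) n"
    by simp
  moreover have coeff: "Polynomial.coeff ((X + 1) ^ m) i = of_nat (m choose i)" for m i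
    using binom[of 1 m] by (simp add: coeff_sum binomial_eq_0)
  ultimately have "of_nat (k choose n) = (\<Sum>i\<le>k div p. if n < i * p then 0
      else of_nat ((k div p) choose i) * of_nat ((k mod p) choose (n - i * p)) :: 'a)"
    unfolding binom by (simp add: sum_distrib_right coeff_sum coeff_monom_mult cong: if_cong)
  also have "\<dots> = (\<Sum>i\<in>{..k div p} \<inter> {n div p}. of_nat ((k div p) choose i)
      * of_nat ((k mod p) choose (n mod p)))"
  proof (intro sum.mono_neutral_cong_right ballI)
    fix i assume i: "i \<in> {..k div p} - {..k div p} \<inter> {n div p}"
    show "(if n < i * p then 0 else of_nat ((k div p) choose i) * of_nat ((k mod p) choose (n - i * p))) = (0::'a)"
    proof (cases "n < i * p")
      case False
      then have "i < n div p"
        using i \<open>p > 0\<close> by (auto simp: less_eq_div_iff_mult_less_eq not_less le_neq_implies_less)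
      then have "Suc i * p \<le> n"
        using \<open>p > 0\<close> by (subst less_eq_div_iff_mult_less_eq[symmetric]) auto
      moreover have "k mod p < p"
        using \<open>p > 0\<close> by simp
      ultimately have "k mod p < n - i * p"
        by simp
      then show ?thesis
        by (simp add: binomial_eq_0)
    qed simp
  next
    fix i assume "i \<in> {..k div p} \<inter> {n div p}"
    then have i: "i = n div p"
      by auto
    have "\<not> n < n div p * p"
      by (simp add: not_less)
    then show "(if n < i * p then 0 else of_nat ((k div p) choose i) * of_nat ((k mod p) choose (n - i * p))) =
        (of_nat ((k div p) choose i) * of_nat ((k mod p) choose (n mod p)) :: 'a)"
      by (simp only: i if_False minus_div_mult_eq_mod)
  qed auto
  also have "\<dots> = of_nat ((k div p) choose (n div p)) * of_nat ((k mod p) choose (n mod p))"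
    by (cases "n div p \<le> k div p") (simp_all add: binomial_eq_0 Int_insert_right)
  finally show ?thesis
    by (simp add: p_def)
qed

lemma power_mod_cycle:
  assumes "P (c mod m)" "\<And>x. P x \<Longrightarrow> P ((c * x) mod m)" "P (1 mod m)"
  shows "P (c ^ n mod m :: nat)"
proof (induction n)
  case (Suc n)
  have "c ^ Suc n mod m = (c * (c ^ n mod m)) mod m"
    by (simp add: mod_mult_right_eq)
  with Suc assms(2) show ?case
    by simp
qed (use assms in simp)

section \<open>Quintics over fields whose order is not divisible by 5\<close>

context permuting_quintic
begin

lemma coprime_5: "coprime 5 CHAR('a)" if "q mod 5 \<noteq> 0"
proof -
  obtain n where n: "q = CHAR('a) ^ n"
    using q_power by blast
  have "n \<noteq> 0"
    using n q_ge_2 by (cases n) auto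
  then have "CHAR('a) dvd q"
    using n by (simp add: dvd_power)
  then have "\<not> 5 dvd CHAR('a)"
    using that by (metis dvd_trans mod_0_imp_dvd dvd_imp_mod_0)
  then show ?thesis
    by (intro prime_imp_coprime) auto
qed

lemma five_neq_0: "(5::'a) \<noteq> 0" if "q mod 5 \<noteq> 0"
  using coprime_5[OF that] by (auto simp: numeral_eq_0_iff_CHAR coprime_iff_gcd_eq_1)

lemma char_power_2_dvd_q: "CHAR('a) ^ 2 dvd q \<or> q \<in> {1, CHAR('a)}"
  using char_dvd_q[of 2] by (auto simp: less_2_cases_iff)

lemma char_power_3_dvd_q: "CHAR('a) ^ 3 dvd q \<or> q \<in> {1, CHAR('a), CHAR('a) ^ 2}"
  using char_dvd_q[of 3] by (auto simp: less_Suc_eq eval_nat_numeral)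

text \<open>Here r = 3 and w = 2. In characteristic 3 this coefficient vanishes identically, so
  larger r are needed; in characteristic 2 the division by 2 is avoided by k = 3 mod 4.\<close>

lemma mod_5_eq_2:
  assumes "q mod 5 = 2" "q \<noteq> 2"
  shows "a\<^sup>2 = 5 * b"
proof -
  obtain n where n: "q = CHAR('a) ^ n"
    using q_power by blast
  define k where "k = (q + 3) div 5"
  have k: "5 * k = q + 3"
    using assms(1) unfolding k_def by presburger
  have q7: "q \<ge> 7"
    using assms by presburger
  have co: "coprime 5 CHAR('a)"
    using coprime_5 assms by auto
  have c2: "of_nat k * b + of_nat (k choose 2) * a\<^sup>2 = 0"
    using hermite_coeff[OF k, of 2] q7 coeff_trinomial_power_2[of a b k] by simp
  consider "CHAR('a) = 2" | "CHAR('a) = 3" | "CHAR('a) \<noteq> 2" "CHAR('a) \<noteq> 3"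
    by blast
  then show ?thesis
  proof cases
    case 1
    then have two: "(2::'a) = 0"
      by (simp add: numeral_eq_0_iff_CHAR)
    have "2 ^ 2 dvd q"
      using char_power_2_dvd_q 1 q7 by auto
    moreover from this have "q \<ge> 12"
      using assms(1) by simp presburger
    ultimately have "Polynomial.coeff ([:1, a, b:] ^ k) 2 = Polynomial.coeff ([:1, a, b:] ^ 3) 2"
      using 1 co k by (intro coeff_cong[of k 3 2 3]) auto
    then have *: "3 * b + 3 * a\<^sup>2 = 0"
      using c2 unfolding coeff_trinomial_power_2 by (simp add: eval_nat_numeral)
    have "a\<^sup>2 - 5 * b = (3 * b + 3 * a\<^sup>2) - 2 * (4 * b + a\<^sup>2)"
      by algebra
    also have "\<dots> = 0"
      unfolding * two by simp
    finally show ?thesis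
      by simp
  next
    case 2
    then have three: "(3::'a) = 0"
      by (simp add: numeral_eq_0_iff_CHAR)
    have "q mod 20 \<in> {1, 3, 9, 7}"
      unfolding n 2 by (rule power_mod_cycle) auto
    moreover have "q mod 20 mod 5 = q mod 5"
      by (rule mod_mod_cancel) simp
    ultimately have q20: "q mod 20 = 7"
      using assms(1) by auto
    have q27: "27 dvd q"
      using char_power_3_dvd_q 2 assms by auto
    show ?thesis
    proof (cases "a = 0")
      case a0: True
      have "364 * b ^ 11 = b ^ 11 + 3 * (121 * b ^ 11)"
        by simp
      then have not_364: "364 * b ^ 11 \<noteq> 0"
        unfolding three using b_nz by simp
      have False
      proof (cases "q = 27")
        case True
        \<comment> \<open>The field is too small for r = 43, but k = (27 + 43) / 5 = 14 still works:
          of its two indices, 9 is odd and contributes nothing because a = 0.\<close>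
        have S: "{w. w \<le> 2 * 14 \<and> q - 1 dvd 5 * 14 - 2 * w} = {9, 22}"
        proof (intro equalityI subsetI)
          fix w assume "w \<in> {w. w \<le> 2 * 14 \<and> q - 1 dvd 5 * 14 - 2 * w}"
          then have w: "w \<le> 28" "26 dvd 70 - 2 * w"
            by (auto simp: True)
          then obtain c where "70 - 2 * w = 26 * c"
            by (auto elim: dvdE)
          with w show "w \<in> {9, 22}"
            by simp presburger
        qed (auto simp: True)
        have "\<not> q - 1 dvd 14"
          by (simp add: True)
        then have "(\<Sum>w\<in>{9, 22}. Polynomial.coeff ([:1, a, b:] ^ 14) w) = 0"
          using hermite_sum[of 14, unfolded S] by simp
        moreover have "Polynomial.coeff ([:1, a, b:] ^ 14) 9 = 0"
          unfolding coeff_trinomial_power_9 a0 by simp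
        moreover have "Polynomial.coeff ([:1, a, b:] ^ 14) 22 = of_nat (14 choose 11) * b ^ 11"
          using coeff_trinomial_power_even[of b 14 11] a0 by simp
        moreover have "14 choose 11 = (364::nat)"
          by (simp add: binomial_fact' fact_numeral)
        ultimately have "364 * b ^ 11 = 0"
          by simp
        then show False
          using not_364 by simp
      next
        case False
        then have "q > 45"
          using q27 q7 by (auto elim!: dvdE)
        \<comment> \<open>For a = 0 only an even w = (r + 1) / 2 gives information. Here w = 22, k0
          = 14 since 5 * 14 = 43 mod 27, and (14 choose 11) = 364 is 1 modulo 3.\<close>
        define k where "k = (q + 43) div 5"
          have k: "5 * k = q + 43"
            using assms(1) unfolding k_def by presburger
        have "Polynomial.coeff ([:1, a, b:] ^ k) 22 = Polynomial.coeff ([:1, a, b:] ^ 14) 22"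
          using 2 co k \<open>q > 45\<close> q27 by (intro coeff_cong[of k 43 3 14]) auto
        then have "Polynomial.coeff ([:1, 0, b:] ^ 14) (2 * 11) = 0"
          using hermite_coeff[OF k, of 22] \<open>q > 45\<close> a0 by simp
        moreover have "14 choose 11 = (364::nat)"
          by (simp add: binomial_fact' fact_numeral)
        ultimately have "364 * b ^ 11 = 0"
          unfolding coeff_trinomial_power_even by simp
        then show False
          using not_364 by simp
      qed
      then show ?thesis ..
    next
      case a0: False
      \<comment> \<open>Now w = 7, and k0 = 8 since 5 * 8 = 13 mod 9.\<close>
      define k where "k = (q + 13) div 5"
      have k: "5 * k = q + 13"
          using assms(1) unfolding k_def by presburger
      have "q \<ge> 27"
        using q27 q7 by (auto dest: dvd_imp_le)
      have "9 dvd q"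
        using q27 by (rule dvd_trans[rotated]) simp
      then have "Polynomial.coeff ([:1, a, b:] ^ k) 7 = Polynomial.coeff ([:1, a, b:] ^ 8) 7"
        using 2 co k \<open>q \<ge> 27\<close> by (intro coeff_cong[of k 13 2 8]) auto
      then have c: "Polynomial.coeff ([:1, a, b:] ^ 8) 7 = 0"
        using hermite_coeff[OF k, of 7] \<open>q \<ge> 27\<close> by simp
      have "8 choose 4 = (70::nat)" "8 choose 5 = (56::nat)" "8 choose 6 = (28::nat)" "8 choose 7 = (8::nat)"
        by (simp_all add: binomial_fact' fact_numeral)
      then have "280 * a * b ^ 3 + 560 * a ^ 3 * b\<^sup>2 + 168 * a ^ 5 * b + 8 * a ^ 7 = 0" (is "?rel = 0")
        using c unfolding coeff_trinomial_power_7 by simp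
      \<comment> \<open>The factorization modulo 3 of the coefficient. The factor a^2 + b is a^2 -
        5b, and a zero of the last factor would make -1 a square.\<close>
      moreover have "a * ((a\<^sup>2 + b) * ((a\<^sup>2 + b)\<^sup>2 + b\<^sup>2)) =
          2 * ?rel - 3 * (5 * a ^ 7 + 111 * a ^ 5 * b + 372 * a ^ 3 * b\<^sup>2 + 186 * a * b ^ 3)"
        by algebra
      ultimately have "a * ((a\<^sup>2 + b) * ((a\<^sup>2 + b)\<^sup>2 + b\<^sup>2)) = 0"
        by (simp only: three) simp
      then consider "a\<^sup>2 + b = 0" | "(a\<^sup>2 + b)\<^sup>2 + b\<^sup>2 = 0"
        using a0 by auto
      then show ?thesis
      proof cases
        case 1
        have "a\<^sup>2 - 5 * b = (a\<^sup>2 + b) - 3 * (2 * b)"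
          by algebra
        also have "\<dots> = 0"
          unfolding 1 three by simp
        finally show ?thesis
          by simp
      next
        case 2
        define t where "t = (a\<^sup>2 + b) / b"
        have "t \<in> K"
          using a_mem b_mem by (simp add: t_def)
        have t2: "t\<^sup>2 = - 1"
          using 2 b_nz by (simp add: t_def field_simps eq_neg_iff_add_eq_0)
        then have "t \<noteq> 0"
          by auto
        obtain j where "q = 20 * j + 7"
          by (metis mult_div_mod_eq q20)
        then have "q - 1 = 2 * (10 * j + 3)"
          by simp
        then have "t ^ (q - 1) = (t\<^sup>2) ^ (10 * j + 3)"
          by (simp only: power_mult)
        also have "\<dots> = - 1"
          unfolding t2 by simp
        finally have two: "(2::'a) = 0"
          using power_units[OF \<open>t \<in> K\<close> \<open>t \<noteq> 0\<close>] by (metis one_add_one add.right_inverse)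
        have "(1::'a) = 3 - 2"
          by simp
        also have "\<dots> = 0"
          unfolding three two by simp
        finally show ?thesis
          by simp
      qed
    qed
  next
    case 3
    have "(3::'a) \<noteq> 0" "(2::'a) \<noteq> 0"
      by (rule numeral_neq_0_CHAR; use 3 in simp)+
    have x1: "5 * of_nat (k choose 1) = (3::'a)"
      using five_k[OF k] by simp
    have x2: "5 * 5 * of_nat (k choose 2) = (- 3::'a)"
      by (rule binomial_scaled_step[OF k x1, of 2]) (use \<open>(2::'a) \<noteq> 0\<close> in simp_all)
    have "0 = 25 * (of_nat (k choose 1) * b + of_nat (k choose 2) * a\<^sup>2)"
      using c2 by simp
    also have "\<dots> = 5 * (5 * of_nat (k choose 1)) * b + (5 * 5 * of_nat (k choose 2)) * a\<^sup>2"
      by algebra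
    also have "\<dots> = 3 * (5 * b - a\<^sup>2)"
      unfolding x1 x2 by algebra
    finally have "3 * (5 * b - a\<^sup>2) = 0" ..
    then have "5 * b - a\<^sup>2 = 0"
      using \<open>(3::'a) \<noteq> 0\<close> mult_eq_0_iff by blast
    then show ?thesis
      by simp
  qed
qed

text \<open>First r = 1 gives a = 0; then r = 11 gives (k choose 3) = 0, formally 11/125. Powers of
  11 are 1 mod 5, so 11 is nonzero here. The orders 4 and 9 are too small for r = 11, and 9 really
  is an exception.\<close>

lemma mod_5_eq_4:
  assumes "q mod 5 = 4"
  shows "q = 9 \<and> a = 0 \<and> b\<^sup>2 = - 1"
proof -
  obtain n where n: "q = CHAR('a) ^ n"
    using q_power by blast
  have co: "coprime 5 CHAR('a)"
    using coprime_5 assms by auto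
  have a0: "a = 0"
  proof -
    define k where "k = (q + 1) div 5"
    have k: "5 * k = q + 1"
      using assms unfolding k_def by presburger
    have "q \<ge> 4"
      using assms by presburger
    then have "of_nat k * a = 0"
      using hermite_coeff[OF k, of 1] coeff_trinomial_power_1[of a b k] by simp
    then have "5 * of_nat k * a = 0"
      by simp
    then show ?thesis
      using five_k[OF k] by simp
  qed
  define k where "k = (q + 11) div 5"
  have k: "5 * k = q + 11"
    using assms unfolding k_def by presburger
  have c3: "of_nat (k choose 3) = (0::'a)" if "q > 13"
    using hermite_coeff[OF k, of 6] coeff_trinomial_power_even[of b k 3] that a0 b_nz by simp
  have "q = 4 \<or> q = 9 \<or> q > 13"
    using assms by presburger
  then consider "q = 4" | "q = 9" | "q > 13"
    by blast
  then show ?thesis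
  proof cases
    case 1
    have "of_nat 4 = (0::'a)"
      using of_nat_q 1 by simp
    then have "CHAR('a) dvd 2 ^ 2"
      by (simp only: of_nat_eq_0_iff_char_dvd) simp
    then have "CHAR('a) dvd 2"
      using prime_dvd_power CHAR_prime by blast
    then have two: "(2::'a) = 0"
      by (simp add: numeral_eq_0_iff_CHAR)
    \<comment> \<open>Over four elements b^4 = b, so the quintic takes the value 2 b^2 = 0 at b as
      well as at 0.\<close>
    have "b ^ 5 + a * b ^ 3 + b * b = b ^ 4 * b + b * b"
      by (simp add: a0 eval_nat_numeral)
    also have "\<dots> = 2 * b\<^sup>2"
      using power_q[OF b_mem] 1 by (simp add: power2_eq_square)
    finally have "b ^ 5 + a * b ^ 3 + b * b = 0 ^ 5 + a * 0 ^ 3 + b * 0"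
      by (simp add: two)
    then have "b = 0"
      using inj_onD[OF bij_betw_imp_inj_on[OF bij] _ b_mem zero_mem] by simp
    then show ?thesis
      using b_nz by simp
  next
    case 2
    have S: "{w. w \<le> 2 * 4 \<and> q - 1 dvd 5 * 4 - 2 * w} = {2, 6}"
    proof (intro equalityI subsetI)
      fix w assume "w \<in> {w. w \<le> 2 * 4 \<and> q - 1 dvd 5 * 4 - 2 * w}"
      then have w: "w \<le> 8" "8 dvd 20 - 2 * w"
        by (auto simp: 2)
      then obtain c where "20 - 2 * w = 8 * c"
        by (auto elim: dvdE)
      with w show "w \<in> {2, 6}"
        by simp presburger
    qed (auto simp: 2)
    have "\<not> q - 1 dvd 4"
      by (simp add: 2)
    then have "(\<Sum>w\<in>{2, 6}. Polynomial.coeff ([:1, a, b:] ^ 4) w) = 0"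
      using hermite_sum[of 4, unfolded S] by simp
    then have *: "4 * b + 4 * b ^ 3 = 0"
      using coeff_trinomial_power_even[of b 4 1] coeff_trinomial_power_even[of b 4 3] a0
      by (simp add: eval_nat_numeral)
    have "of_nat 9 = (0::'a)"
      using of_nat_q 2 by simp
    then have nine: "(9::'a) = 0"
      by simp
    have "b * (b\<^sup>2 + 1) = 9 * (b * (b\<^sup>2 + 1)) - 2 * (4 * b + 4 * b ^ 3)"
      by algebra
    then have "b * (b\<^sup>2 + 1) = 0"
      unfolding * nine by simp
    then show ?thesis
      using 2 a0 b_nz by (simp add: eq_neg_iff_add_eq_0)
  next
    case 3
    have "CHAR('a) \<noteq> 11"
    proof
      assume 11: "CHAR('a) = 11"
      have "q mod 5 \<in> {1}"
        unfolding n 11 by (rule power_mod_cycle) auto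
      then show False
        using assms by simp
    qed
    have "CHAR('a) \<noteq> 2"
    proof
      assume 2: "CHAR('a) = 2"
      have "[5 * k = 5 * 3] (mod 2 ^ 2)"
        using char_power_2_dvd_q 2 3 k by (auto simp: cong_def elim!: dvdE)
      then have "[k = 3] (mod 2 ^ 2)"
        by (subst (asm) cong_mult_lcancel_nat) (auto simp: coprime_iff_gcd_eq_1 gcd_non_0_nat)
      then have "of_nat (k choose 3) = (of_nat (3 choose 3) :: 'a)"
        using 2 k 3 by (intro of_nat_binomial_cong[where s = 2]) (auto simp: cong_def)
      then show False
        using c3 3 by simp
    qed
    moreover have "CHAR('a) \<noteq> 3"
    proof
      assume 2: "CHAR('a) = 3"
      have "[5 * k = 5 * 4] (mod 3 ^ 2)"
        using char_power_2_dvd_q 2 3 k by (auto simp: cong_def elim!: dvdE)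
      then have "[k = 4] (mod 3 ^ 2)"
        by (subst (asm) cong_mult_lcancel_nat) (auto simp: coprime_iff_gcd_eq_1 gcd_non_0_nat)
      then have "of_nat (k choose 3) = (of_nat (4 choose 3) :: 'a)"
        using 2 k 3 by (intro of_nat_binomial_cong[where s = 2]) (auto simp: cong_def)
      then have "of_nat 4 = (0::'a)"
        using c3 3 by (simp add: eval_nat_numeral)
      then show False
        by (simp only: of_nat_eq_0_iff_char_dvd 2) simp
    qed
    ultimately have nz: "(2::'a) \<noteq> 0" "(3::'a) \<noteq> 0" "(11::'a) \<noteq> 0"
      using \<open>CHAR('a) \<noteq> 11\<close> by (simp_all add: numeral_neq_0_CHAR)
    have x1: "5 * of_nat (k choose 1) = (11::'a)"
      using five_k[OF k] by simp
    have x2: "5 * 5 * of_nat (k choose 2) = (33::'a)"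
      by (rule binomial_scaled_step[OF k x1, of 2]) (use nz in simp_all)
    have "5 * 5 * 5 * of_nat (k choose 3) = (11::'a)"
      by (rule binomial_scaled_step[OF k x2, of 3]) (use nz in simp_all)
    then have "(11::'a) = 0"
      using c3[OF 3] by simp
    then show ?thesis
      using nz by simp
  qed
qed

text \<open>The choice r = 7 leaves two factors, and r = 17 decides between them where q > 19.
  Characteristics 2, 3 and 7 spoil the formal computation for r = 7, and 17 spoils the one for r =
  17.\<close>

lemma mod_5_eq_3:
  assumes "q mod 5 = 3" "q \<noteq> 3"
  shows "a\<^sup>2 = 5 * b \<or> q = 13 \<and> 2 * a\<^sup>2 = 5 * b"
proof -
  obtain n where n: "q = CHAR('a) ^ n"
    using q_power by blast
  have co: "coprime 5 CHAR('a)" and five: "(5::'a) \<noteq> 0"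
    using coprime_5 five_neq_0 assms by auto
  define k where "k = (q + 7) div 5"
  have k: "5 * k = q + 7"
    using assms unfolding k_def by presburger
  define l where "l = (q + 17) div 5"
  have l: "5 * l = q + 17"
    using assms unfolding l_def by presburger
  have q7: "q \<ge> 8"
    using assms by presburger
  have c4: "of_nat (k choose 2) * b\<^sup>2 + 3 * of_nat (k choose 3) * a\<^sup>2 * b + of_nat (k choose 4) * a ^ 4 = 0" if "q > 9"
    using hermite_coeff[OF k, of 4] that coeff_trinomial_power_4[of a b k] by simp
  have c9: "Polynomial.coeff ([:1, a, b:] ^ l) 9 = 0" if "q > 19"
    using hermite_coeff[OF l, of 9] that by simp
  consider "CHAR('a) = 2" | "CHAR('a) = 3" | "CHAR('a) = 7" | "CHAR('a) \<notin> {2, 3, 7}"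
    by blast
  then show ?thesis
  proof cases
    case 1
    then have two: "(2::'a) = 0"
      by (simp add: numeral_eq_0_iff_CHAR)
    have q8: "8 dvd q"
      using char_power_3_dvd_q 1 assms by auto
    have "Polynomial.coeff ([:1, a, b:] ^ 3) 4 = 0"
    proof (cases "q = 8")
      case True
      \<comment> \<open>The bound r + 2 < q fails for r = 7, but k = 3 still leaves a single
        index.\<close>
      have S: "{w. w \<le> 2 * 3 \<and> q - 1 dvd 5 * 3 - 2 * w} = {4}"
      proof (intro equalityI subsetI)
        fix w assume "w \<in> {w. w \<le> 2 * 3 \<and> q - 1 dvd 5 * 3 - 2 * w}"
        then have w: "w \<le> 6" "7 dvd 15 - 2 * w"
          by (auto simp: True)
        then obtain c where "15 - 2 * w = 7 * c"
          by (auto elim: dvdE)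
        with w show "w \<in> {4}"
          by simp presburger
      qed (auto simp: True)
      have "\<not> q - 1 dvd 3"
        by (simp add: True)
      then show ?thesis
        using hermite_sum[of 3, unfolded S] by simp
    next
      case False
      then have "q \<ge> 16"
        using q8 q7 by (auto elim!: dvdE)
      then have "Polynomial.coeff ([:1, a, b:] ^ k) 4 = Polynomial.coeff ([:1, a, b:] ^ 3) 4"
        using 1 co k q8 by (intro coeff_cong[of k 7 3 3]) auto
      then show ?thesis
        using hermite_coeff[OF k, of 4] \<open>q \<ge> 16\<close> by simp
    qed
    then have *: "3 * b\<^sup>2 + 3 * a\<^sup>2 * b = 0"
      unfolding coeff_trinomial_power_4 by (simp add: eval_nat_numeral)
    have "(a\<^sup>2 - 5 * b) * b = (3 * b\<^sup>2 + 3 * a\<^sup>2 * b) - 2 * (4 * b\<^sup>2 + a\<^sup>2 * b)"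
      by algebra
    also have "\<dots> = 0"
      unfolding * two by simp
    finally show ?thesis
      using b_nz by simp
  next
    case 2
    then have three: "(3::'a) = 0"
      by (simp add: numeral_eq_0_iff_CHAR)
    have q27: "27 dvd q"
      using char_power_3_dvd_q 2 assms by auto
    then have q20: "q > 20"
      using q7 by (auto dest: dvd_imp_le)
    have "9 dvd q"
      using q27 by (rule dvd_trans[rotated]) simp
    then have "Polynomial.coeff ([:1, a, b:] ^ k) 4 = Polynomial.coeff ([:1, a, b:] ^ 5) 4"
      using 2 co k q20 by (intro coeff_cong[of k 7 2 5]) auto
    then have c: "Polynomial.coeff ([:1, a, b:] ^ 5) 4 = 0"
      using hermite_coeff[OF k, of 4] q20 by simp
    have "5 choose 2 = (10::nat)" "5 choose 3 = (10::nat)" "5 choose 4 = (5::nat)"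
      by (simp_all add: binomial_fact' fact_numeral)
    then have "10 * b\<^sup>2 + 30 * a\<^sup>2 * b + 5 * a ^ 4 = 0" (is "?rel = 0")
      using c unfolding coeff_trinomial_power_4 by simp
    moreover have "(a\<^sup>2 + b) * (a\<^sup>2 - b) = 3 * (2 * a ^ 4 + 10 * a\<^sup>2 * b + 3 * b\<^sup>2) - ?rel"
      by algebra
    ultimately have "(a\<^sup>2 + b) * (a\<^sup>2 - b) = 0"
      by (simp only: three) simp
    then consider "a\<^sup>2 + b = 0" | "b = a\<^sup>2"
      by auto
    then show ?thesis
    proof cases
      case 1
      have "a\<^sup>2 - 5 * b = (a\<^sup>2 + b) - 3 * (2 * b)"
        by algebra
      also have "\<dots> = 0"
        unfolding 1 three by simp
      finally show ?thesis
        by simp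
    next
      case b: 2
      obtain j where j: "q = 27 * j"
        using q27 by (auto elim: dvdE)
      have "j \<noteq> 0" "j \<noteq> 1" "j \<noteq> 2" "j \<noteq> 3"
        using assms(1) unfolding j by auto
      then have "q \<ge> 108"
        unfolding j by linarith
      \<comment> \<open>5 * 25 = 17 mod 27; the bound 108 is exactly what makes l at least
        25.\<close>
      have "Polynomial.coeff ([:1, a, b:] ^ l) 9 = Polynomial.coeff ([:1, a, b:] ^ 25) 9"
        using 2 co l q27 \<open>q \<ge> 108\<close> by (intro coeff_cong[of l 17 3 25]) auto
      moreover have "25 choose 5 = (53130::nat)" "25 choose 6 = (177100::nat)" "25 choose 7 = (480700::nat)"
        "25 choose 8 = (1081575::nat)" "25 choose 9 = (2042975::nat)"
        by (simp_all add: binomial_fact' fact_numeral)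
      ultimately have "265650 * a * b ^ 4 + 3542000 * a ^ 3 * b ^ 3 + 10094700 * a ^ 5 * b\<^sup>2 + 8652600 * a ^ 7 * b
          + 2042975 * a ^ 9 = 0" (is "?rel = 0")
        using c9 q20 unfolding coeff_trinomial_power_9 by simp
      moreover have "?rel = 24597925 * a ^ 9"
        unfolding b by algebra
      moreover have "a \<noteq> 0"
        using b b_nz by auto
      ultimately have "of_nat 24597925 = (0::'a)"
        by simp
      then show ?thesis
        by (simp only: of_nat_eq_0_iff_char_dvd 2) simp
    qed
  next
    case 3
    then have seven: "(7::'a) = 0"
      by (simp add: numeral_eq_0_iff_CHAR)
    have q343: "343 dvd q"
      using char_power_3_dvd_q 3 assms by auto
    then have q20: "q \<ge> 343"
      using q7 by (auto dest: dvd_imp_le)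
    have q49: "49 dvd q"
      using q343 by (rule dvd_trans[rotated]) simp
    have "Polynomial.coeff ([:1, a, b:] ^ l) 9 = Polynomial.coeff ([:1, a, b:] ^ 23) 9"
      using 3 co l q49 q20 by (intro coeff_cong[of l 17 2 23]) auto
    moreover have "23 choose 5 = (33649::nat)" "23 choose 6 = (100947::nat)" "23 choose 7 = (245157::nat)"
        "23 choose 8 = (490314::nat)" "23 choose 9 = (817190::nat)"
      by (simp_all add: binomial_fact' fact_numeral)
    ultimately have "168245 * a * b ^ 4 + 2018940 * a ^ 3 * b ^ 3 + 5148297 * a ^ 5 * b\<^sup>2 + 3922512 * a ^ 7 * b + 817190 * a ^ 9 = 0"
      (is "?rel = 0")
      using c9 q20 unfolding coeff_trinomial_power_9 by simp
    moreover have "a ^ 7 * (a\<^sup>2 - 5 * b) = 7 * (- 120175 * a * b ^ 4 - 1442100 * a ^ 3 * b ^ 3 - 3677355 * a ^ 5 * b\<^sup>2 - 2801795 * a ^ 7 * b - 583707 * a ^ 9) + 5 * ?rel"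
      by algebra
    ultimately have "a ^ 7 * (a\<^sup>2 - 5 * b) = 0"
      by (simp only: seven) simp
    then consider "a = 0" | "a\<^sup>2 = 5 * b"
      by auto
    then show ?thesis
    proof cases
      case a0: 1
      \<comment> \<open>As a = 0, an even index is needed again: w = 14, with 5 * 25 = 27 mod 49,
        and 7 does not divide (25 choose 7).\<close>
      define m where "m = (q + 27) div 5"
      have m: "5 * m = q + 27"
        using assms unfolding m_def by presburger
      have "Polynomial.coeff ([:1, a, b:] ^ m) 14 = Polynomial.coeff ([:1, a, b:] ^ 25) 14"
        using 3 co m q49 q20 by (intro coeff_cong[of m 27 2 25]) auto
      then have "Polynomial.coeff ([:1, 0, b:] ^ 25) (2 * 7) = 0"
        using hermite_coeff[OF m, of 14] q20 a0 by simp
      then have "of_nat (25 choose 7) = (0::'a)"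
        unfolding coeff_trinomial_power_even using b_nz by simp
      moreover have "25 choose 7 = (480700::nat)"
        by (simp add: binomial_fact' fact_numeral)
      ultimately have "7 dvd (480700::nat)"
        using 3 by (simp only: of_nat_eq_0_iff_char_dvd)
      then show ?thesis
        by simp
    qed auto
  next
    case 4
    have nz: "(2::'a) \<noteq> 0" "(3::'a) \<noteq> 0" "(7::'a) \<noteq> 0"
      using 4 by (simp_all add: numeral_neq_0_CHAR)
    have "q \<noteq> 8"
    proof
      assume "q = 8"
      then have "of_nat 8 = (0::'a)"
        using of_nat_q by metis
      then have "CHAR('a) dvd 2 ^ 3"
        by (simp only: of_nat_eq_0_iff_char_dvd) simp
      then have "CHAR('a) dvd 2"
        using prime_dvd_power CHAR_prime by blast
      then show False
        using nz by (simp add: numeral_eq_0_iff_CHAR)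
    qed
    then have "q > 9"
      using assms by presburger
    have x1: "5 * of_nat (k choose 1) = (7::'a)"
      using five_k[OF k] by simp
    have x2: "5 * 5 * of_nat (k choose 2) = (7::'a)"
      by (rule binomial_scaled_step[OF k x1, of 2]) (use nz in simp_all)
    have x3: "5 * 5 * 5 * of_nat (k choose 3) = (- 7::'a)"
      by (rule binomial_scaled_step[OF k x2, of 3]) (use nz in simp_all)
    have "(4::'a) = 2 * 2"
      by simp
    then have "(4::'a) \<noteq> 0"
      using nz by (metis mult_eq_0_iff)
    then have x4: "5 * 5 * 5 * 5 * of_nat (k choose 4) = (14::'a)"
      by (intro binomial_scaled_step[OF k x3, of 4]) simp_all
    have "0 = 625 * (of_nat (k choose 2) * b\<^sup>2 + 3 * of_nat (k choose 3) * a\<^sup>2 * b + of_nat (k choose 4) * a ^ 4)"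
      using c4[OF \<open>q > 9\<close>] by simp
    also have "\<dots> = 25 * (5 * 5 * of_nat (k choose 2)) * b\<^sup>2 + 15 * (5 * 5 * 5 * of_nat (k choose 3)) * a\<^sup>2 * b
        + (5 * 5 * 5 * 5 * of_nat (k choose 4)) * a ^ 4"
      by algebra
    also have "\<dots> = 7 * ((a\<^sup>2 - 5 * b) * (2 * a\<^sup>2 - 5 * b))"
      unfolding x2 x3 x4 by algebra
    finally have "7 * ((a\<^sup>2 - 5 * b) * (2 * a\<^sup>2 - 5 * b)) = 0" ..
    then have "(a\<^sup>2 - 5 * b) * (2 * a\<^sup>2 - 5 * b) = 0"
      using nz mult_eq_0_iff by blast
    then consider "a\<^sup>2 = 5 * b" | "2 * a\<^sup>2 = 5 * b" "q = 13" | "2 * a\<^sup>2 = 5 * b" "q \<noteq> 13"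
      by auto
    then show ?thesis
    proof cases
      case b: 3
      have "q \<noteq> 18"
      proof
        assume "q = 18"
        then have "of_nat 18 = (0::'a)"
          using of_nat_q by metis
        then have "CHAR('a) dvd 2 * 3 ^ 2"
          by (simp only: of_nat_eq_0_iff_char_dvd) simp
        then have "CHAR('a) dvd 2 \<or> CHAR('a) dvd 3"
          using prime_dvd_power CHAR_prime prime_dvd_mult_iff by blast
        then show False
          using nz by (simp add: numeral_eq_0_iff_CHAR)
      qed
      then have "q > 19"
        using \<open>q > 9\<close> assms(1) b(2) by presburger
      have "a \<noteq> 0"
        using b(1) b_nz five by auto
      have nz': "(4::'a) \<noteq> 0" "(6::'a) \<noteq> 0" "(8::'a) \<noteq> 0" "(9::'a) \<noteq> 0"
        using nz mult_eq_0_iff[of "2::'a" 2] mult_eq_0_iff[of "2::'a" 3] mult_eq_0_iff[of "4::'a" 2]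
          mult_eq_0_iff[of "3::'a" 3] by auto
      \<comment> \<open>The coefficient of \<open>z\<^sup>9\<close> in \<open>(1 + z + 2/5 z\<^sup>2)\<close> to the power \<open>17/5\<close> is \<open>17 / 5\<^sup>9\<close>.\<close>
      have y1: "5 * of_nat (l choose 1) = (17::'a)"
        using five_k[OF l] by simp
      have y2: "5 * 5 * of_nat (l choose 2) = (102::'a)"
        by (rule binomial_scaled_step[OF l y1, of 2]) (use nz in simp_all)
      have y3: "5 * 5 * 5 * of_nat (l choose 3) = (238::'a)"
        by (rule binomial_scaled_step[OF l y2, of 3]) (use nz in simp_all)
      have y4: "5 * 5 * 5 * 5 * of_nat (l choose 4) = (119::'a)"
        by (rule binomial_scaled_step[OF l y3, of 4]) (use nz' in simp_all)
      \<comment> \<open>357 is not divisible by 5, so nothing is cancelled and the full factor 25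
        enters the scale; this is why 5^10 clears all denominators below.\<close>
      have y5: "5 * 5 * 5 * 5 * 25 * of_nat (l choose 5) = (- 357::'a)"
        by (rule binomial_scaled_step[OF l y4, of 1]) simp_all
      have y6: "5 * 5 * 5 * 5 * 25 * 5 * of_nat (l choose 6) = (476::'a)"
        by (rule binomial_scaled_step[OF l y5, of 6]) (use nz' in simp_all)
      have y7: "5 * 5 * 5 * 5 * 25 * 5 * 5 * of_nat (l choose 7) = (- 884::'a)"
        by (rule binomial_scaled_step[OF l y6, of 7]) (use nz in simp_all)
      have y8: "5 * 5 * 5 * 5 * 25 * 5 * 5 * 5 * of_nat (l choose 8) = (1989::'a)"
        by (rule binomial_scaled_step[OF l y7, of 8]) (use nz' in simp_all)
      have y9: "5 * 5 * 5 * 5 * 25 * 5 * 5 * 5 * 5 * of_nat (l choose 9) = (- 5083::'a)"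
        by (rule binomial_scaled_step[OF l y8, of 9]) (use nz' in simp_all)
      have "0 = 5 ^ 10 * (5 * of_nat (l choose 5) * a * b ^ 4 + 20 * of_nat (l choose 6) * a ^ 3 * b ^ 3
          + 21 * of_nat (l choose 7) * a ^ 5 * b\<^sup>2 + 8 * of_nat (l choose 8) * a ^ 7 * b + of_nat (l choose 9) * a ^ 9)"
        using c9[OF \<open>q > 19\<close>, unfolded coeff_trinomial_power_9] by simp
      also have "\<dots> = 5 * (5 * 5 * 5 * 5 * 25 * of_nat (l choose 5)) * a * (5 * b) ^ 4
          + 20 * (5 * 5 * 5 * 5 * 25 * 5 * of_nat (l choose 6)) * a ^ 3 * (5 * b) ^ 3
          + 21 * (5 * 5 * 5 * 5 * 25 * 5 * 5 * of_nat (l choose 7)) * a ^ 5 * (5 * b)\<^sup>2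
          + 8 * (5 * 5 * 5 * 5 * 25 * 5 * 5 * 5 * of_nat (l choose 8)) * a ^ 7 * (5 * b)
          + (5 * 5 * 5 * 5 * 25 * 5 * 5 * 5 * 5 * of_nat (l choose 9)) * a ^ 9"
        by algebra
      also have "\<dots> = 5 * 17 * a ^ 9"
        unfolding y5 y6 y7 y8 y9 b(1)[symmetric] by algebra
      finally have "5 * 17 * a ^ 9 = 0" ..
      then have "5 * 17 = (0::'a)"
        using \<open>a \<noteq> 0\<close> mult_eq_0_iff power_not_zero by blast
      then have "(17::'a) = 0"
        using five mult_eq_0_iff by blast
      then have p: "CHAR('a) = 17"
        by (simp add: numeral_eq_0_iff_CHAR primes_dvd_imp_eq)
      \<comment> \<open>A third exponent for characteristic 17: w = 19, and 5 * 123 = 37 mod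
        17^2.\<close>
      define m where "m = (q + 37) div 5"
      have m: "5 * m = q + 37"
        using assms unfolding m_def by presburger
      have "17 ^ 3 dvd q"
        using char_power_3_dvd_q p assms by auto
      then have q289: "17 ^ 2 dvd q" and q4913: "q \<ge> 4913"
        using q7 by (auto dest: dvd_imp_le intro: dvd_trans[rotated])
      have "Polynomial.coeff ([:1, a, b:] ^ m) 19 = Polynomial.coeff ([:1, a, b:] ^ 123) 19"
        using p co m q289 q4913 by (intro coeff_cong[of m 37 2 123]) auto
      then have "Polynomial.coeff ([:1, a, b:] ^ 123) 19 = 0"
        using hermite_coeff[OF m, of 19] q4913 by simp
      \<comment> \<open>123 = 7 * 17 + 4, so among the ten binomial coefficients only those with i =
        17, 18, 19 survive.\<close>
      moreover have lucas: "of_nat (123 choose i) = (of_nat (7 choose (i div 17)) * of_nat (4 choose (i mod 17)) :: 'a)" for i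
        using of_nat_binomial_lucas[of 123 i, where ?'a = 'a] p by simp
      ultimately have "952 * a ^ 15 * b\<^sup>2 + 504 * a ^ 17 * b + 42 * a ^ 19 = 0" (is "?rel = 0")
        unfolding coeff_trinomial_power_19 lucas by (simp add: binomial_eq_0 binomial_fact' fact_numeral)
      moreover have "25 * ?rel = 952 * a ^ 15 * (5 * b)\<^sup>2 + 2520 * a ^ 17 * (5 * b) + 1050 * a ^ 19"
        by algebra
      then have "25 * ?rel = 9898 * a ^ 19"
        unfolding b(1)[symmetric] by (simp add: power_mult_distrib flip: power_mult power_add)
      ultimately have "of_nat 9898 = (0::'a)"
        using \<open>a \<noteq> 0\<close> by simp
      then show ?thesis
        by (simp only: of_nat_eq_0_iff_char_dvd p) simp
    qed auto
  qed
qed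

end

section \<open>Odd permutation quintics in characteristic 5\<close>

lemma coeff_pow_CHAR:
  fixes f :: "'a::comm_ring_1 poly"
  assumes "prime CHAR('a)"
  shows "Polynomial.coeff (f ^ CHAR('a)) n =
    (if CHAR('a) dvd n then Polynomial.coeff f (n div CHAR('a)) ^ CHAR('a) else 0)"
proof -
  define p where "p = CHAR('a)"
  have "p > 0"
    using assms by (simp add: p_def prime_gt_0_nat)
  have "f ^ p = (\<Sum>i\<le>degree f. Polynomial.monom (Polynomial.coeff f i) i) ^ p"
    by (simp add: poly_as_sum_of_monoms)
  also have "\<dots> = (\<Sum>i\<le>degree f. Polynomial.monom (Polynomial.coeff f i ^ p) (i * p))"
    using assms by (subst freshmans_dream_sum) (auto simp: p_def monom_power)
  also have "Polynomial.coeff \<dots> n = (\<Sum>i\<le>degree f. if i * p = n then Polynomial.coeff f i ^ p else 0)"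
    by (simp add: coeff_sum)
  also have "\<dots> = (\<Sum>i\<in>{..degree f}. if i = n div p then if p dvd n then Polynomial.coeff f i ^ p else 0 else 0)"
    using \<open>p > 0\<close> by (intro sum.cong) auto
  also have "\<dots> = (if p dvd n then Polynomial.coeff f (n div p) ^ p else 0)"
    using \<open>p > 0\<close> by (auto simp: coeff_eq_0 not_le power_0_left)
  finally show ?thesis
    by (simp add: p_def)
qed

lemma coeff_mult_quartic:
  "Polynomial.coeff ([:c0, c1, c2, c3, c4:] * f) (n + 4) =
    c0 * Polynomial.coeff f (n + 4) + c1 * Polynomial.coeff f (n + 3) + c2 * Polynomial.coeff f (n + 2)
    + c3 * Polynomial.coeff f (n + 1) + c4 * Polynomial.coeff f n"
  "Polynomial.coeff ([:c0, c1, c2, c3, c4:] * f) 1 = c0 * Polynomial.coeff f 1 + c1 * Polynomial.coeff f 0"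
  "Polynomial.coeff ([:c0, c1, c2, c3, c4:] * f) 2 =
    c0 * Polynomial.coeff f 2 + c1 * Polynomial.coeff f 1 + c2 * Polynomial.coeff f 0"
  by (simp_all add: eval_nat_numeral add.assoc)

context permuting_quintic
begin

text \<open>
  In characteristic 5 the difference quotient for the increment \<open>h\<close> is quadratic in \<open>x\<close>; the base of the
  power below is its discriminant.
\<close>
lemma char_5_nonsquare:
  assumes "CHAR('a) = 5" "a \<noteq> 0" "h \<in> K" "h \<noteq> 0"
  shows "(3 * a * (h ^ 4 - a * h\<^sup>2 + b)) ^ ((q - 1) div 2) = - 1"
proof -
  define D where "D = 3 * a * (h ^ 4 - a * h\<^sup>2 + b)"
  have five: "(5::'a) = 0"
    using assms(1) by (simp add: numeral_eq_0_iff_CHAR)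
  have D: "D \<in> K"
    using assms a_mem b_mem by (simp add: D_def)
  have no_root: False if w: "w \<in> K" "w\<^sup>2 = D" for w
  proof -
    \<comment> \<open>The quadratic formula: the leading coefficient is 3a, and the denominator 6a
      equals a because 6 = 1.\<close>
    define x where "x = (w - 3 * a * h) / a"
    have x: "a * x = w - 3 * a * h" "x \<in> K"
      using assms w a_mem by (simp_all add: x_def)
    have "a * (h ^ 4 + b + a * (3 * x\<^sup>2 + 3 * x * h + h\<^sup>2)) =
        a * (h ^ 4 + b + a * h\<^sup>2) + 3 * (a * x)\<^sup>2 + 3 * a * h * (a * x)"
      by algebra
    also have "\<dots> = 5 * (2 * a * h ^ 4 + 2 * a\<^sup>2 * h\<^sup>2 + 2 * a * b - 3 * w * a * h) + 3 * (w\<^sup>2 - D)"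
      unfolding x(1) D_def by algebra
    also have "\<dots> = 0"
      unfolding five w by simp
    finally have "h ^ 4 + b + a * (3 * x\<^sup>2 + 3 * x * h + h\<^sup>2) = 0"
      using assms by simp
    moreover have "(x + h) ^ 5 + a * (x + h) ^ 3 + b * (x + h) - (x ^ 5 + a * x ^ 3 + b * x) =
        h * (h ^ 4 + b + a * (3 * x\<^sup>2 + 3 * x * h + h\<^sup>2)) + 5 * (x ^ 4 * h + 2 * x ^ 3 * h\<^sup>2 + 2 * x\<^sup>2 * h ^ 3 + x * h ^ 4)"
      by algebra
    ultimately have "(x + h) ^ 5 + a * (x + h) ^ 3 + b * (x + h) = x ^ 5 + a * x ^ 3 + b * x"
      unfolding five by simp
    then have "x + h = x"
      using inj_onD[OF bij_betw_imp_inj_on[OF bij], of "x + h" x] x assms by simp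
    then show False
      using assms by simp
  qed
  have "D \<noteq> 0"
    using no_root[of 0] by auto
  have "odd q"
    using q_power assms(1) by auto
  then have "(q - 1) div 2 * 2 = q - 1" "2 dvd q - 1"
    by auto
  then have "(D ^ ((q - 1) div 2))\<^sup>2 = 1"
    using power_units[OF D \<open>D \<noteq> 0\<close>] by (simp flip: power_mult)
  moreover have "D ^ ((q - 1) div 2) \<noteq> 1"
    using ex_root[OF \<open>2 dvd q - 1\<close> D \<open>D \<noteq> 0\<close>] no_root by blast
  ultimately show ?thesis
    unfolding D_def by (auto simp: power2_eq_1_iff)
qed

text \<open>Multiply the nonsquare condition by h^(2(M-t)) and sum over h: the right side vanishes,
  and on the left 2M divides 2(M-t) + 2j only for j = t and j = M + t.\<close>

lemma char_5_coeffs: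
  assumes "CHAR('a) = 5" "a \<noteq> 0" "q - 1 = 2 * M" "0 < t" "t < M"
  shows "Polynomial.coeff ([:b, - a, 1:] ^ M) t + Polynomial.coeff ([:b, - a, 1:] ^ M) (M + t) = 0"
proof -
  let ?c = "Polynomial.coeff ([:b, - a, 1:] ^ M)"
  have expand: "(3 * a * (h ^ 4 - a * h\<^sup>2 + b)) ^ M = (3 * a) ^ M * (\<Sum>j\<le>2 * M. ?c j * h ^ (2 * j))" for h
  proof -
    have "degree ([:b, - a, 1:] ^ M) \<le> 2 * M"
      by (rule order.trans[OF degree_power_le]) (auto simp: degree_pCons_le)
    then have "poly ([:b, - a, 1:] ^ M) (h\<^sup>2) = (\<Sum>j\<le>2 * M. ?c j * (h\<^sup>2) ^ j)"
      unfolding poly_altdef by (intro sum.mono_neutral_left) (auto simp: coeff_eq_0)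
    moreover have "h ^ 4 - a * h\<^sup>2 + b = poly [:b, - a, 1:] (h\<^sup>2)"
      by (simp add: algebra_simps eval_nat_numeral)
    ultimately show ?thesis
      by (simp add: power_mult_distrib poly_power flip: power_mult del: poly_pCons)
  qed
  have "\<not> (2 * M) dvd 2 * (M - t)"
    using assms by (auto dest: dvd_imp_le)
  then have "0 = (\<Sum>h\<in>K-{0}. h ^ (2 * (M - t)) * - 1)"
    using sum_power_units[of "2 * (M - t)"] assms(3) by (simp add: sum_negf)
  also have "\<dots> = (\<Sum>h\<in>K-{0}. h ^ (2 * (M - t)) * (3 * a * (h ^ 4 - a * h\<^sup>2 + b)) ^ M)"
    using char_5_nonsquare[OF assms(1,2)] assms(3) by (intro sum.cong refl arg_cong2[of _ _ _ _ "(*)"]) auto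
  also have "\<dots> = (3 * a) ^ M * (\<Sum>j\<le>2 * M. ?c j * (\<Sum>h\<in>K-{0}. h ^ (2 * (M - t) + 2 * j)))"
    unfolding expand by (simp add: sum_distrib_left power_add mult_ac) (rule sum.swap)
  also have "(\<Sum>j\<le>2 * M. ?c j * (\<Sum>h\<in>K-{0}. h ^ (2 * (M - t) + 2 * j))) = (\<Sum>j\<in>{t, M + t}. - ?c j)"
  proof (intro sum.mono_neutral_cong_right ballI)
    fix j assume j: "j \<in> {..2 * M} - {t, M + t}"
    have "\<not> 2 * M dvd 2 * (M - t) + 2 * j"
    proof
      assume "2 * M dvd 2 * (M - t) + 2 * j"
      then obtain c where "2 * (M - t) + 2 * j = 2 * M * c"
        by (elim dvdE)
      then have c: "M - t + j = M * c"
        by linarith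
      have "j \<le> 2 * M"
        using j by auto
      then have "M * c < M * 3" "M * c > 0"
        using c assms(4,5) by linarith+
      then have "c < 3" "c > 0"
        by auto
      then have "c = 1 \<or> c = 2"
        by linarith
      then show False
        using c j assms(4,5) by auto
    qed
    then show "?c j * (\<Sum>h\<in>K-{0}. h ^ (2 * (M - t) + 2 * j)) = 0"
      unfolding sum_power_units assms(3) by simp
  next
    fix j assume "j \<in> {t, M + t}"
    then have "2 * (M - t) + 2 * j = 2 * M * (if j = t then 1 else 2)"
      using assms(4,5) by auto
    then have "2 * M dvd 2 * (M - t) + 2 * j"
      by (metis dvd_triv_left)
    then show "?c j * (\<Sum>h\<in>K-{0}. h ^ (2 * (M - t) + 2 * j)) = - ?c j"
      unfolding sum_power_units assms(3) by simp
  qed (use assms in auto)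
  finally have "(3 * a) ^ M * (?c t + ?c (M + t)) = 0"
    using assms(4,5) by (auto simp: algebra_simps)
  moreover have "(3::'a) \<noteq> 0"
    by (rule numeral_neq_0_CHAR) (use assms(1) in auto)
  ultimately show ?thesis
    using assms(2) by simp
qed

text \<open>Since M = 5m + 2, the M-th power is an explicit quartic times a fifth power G, whose
  exponents are multiples of 5. The relations for t = 1 and t = 2 then involve only two coefficients
  of G. For q = 5 one has M = 2, so t = 2 is out of range.\<close>

lemma char_5:
  assumes "CHAR('a) = 5" "a \<noteq> 0" "q \<noteq> 5"
  shows "a\<^sup>2 = 4 * b"
proof -
  have five: "(5::'a) = 0"
    using assms(1) by (simp add: numeral_eq_0_iff_CHAR)
  obtain n where n: "q = 5 ^ n"
    using q_power assms(1) by auto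
  have "n \<noteq> 0" "n \<noteq> 1"
    using n q_ge_2 assms(3) by - (rule notI; simp)+
  then obtain n' where n': "n = Suc (Suc n')"
    by (metis One_nat_def not0_implies_Suc)
  obtain m where m1: "5 ^ Suc n' = 2 * m + (1::nat)"
    by (rule oddE[of "5 ^ Suc n' :: nat"]) auto
  have "5 ^ Suc n' \<ge> (5::nat)"
    by simp
  then have m: "5 ^ Suc n' = 2 * m + (1::nat)" "m \<ge> 2"
    unfolding m1 by simp_all
  define M where "M = 5 * m + 2"
  have M: "q - 1 = 2 * M"
    using m n n' by (simp add: M_def)
  define G where "G = ([:b, - a, 1:] ^ m) ^ 5"
  have G: "Polynomial.coeff G i = (if 5 dvd i then Polynomial.coeff ([:b, - a, 1:] ^ m) (i div 5) ^ 5 else 0)" for i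
    using coeff_pow_CHAR[of "[:b, - a, 1:] ^ m" i] assms(1) by (simp add: G_def)
  define \<gamma> where "\<gamma> = Polynomial.coeff G (5 * m)"
  have G0: "Polynomial.coeff G 0 = (b ^ m) ^ 5"
    unfolding G by (simp add: coeff_0_power)
  have "[:b, - a, 1:] ^ M = [:b, - a, 1:]\<^sup>2 * G"
    unfolding M_def G_def power_mult[symmetric] power_add by (simp only: mult.commute)
  also have "[:b, - a, 1:]\<^sup>2 = [:b\<^sup>2, - 2 * a * b, a\<^sup>2 + 2 * b, - 2 * a, 1:]"
    by (simp add: power2_eq_square)
  finally have S: "[:b, - a, 1:] ^ M = [:b\<^sup>2, - 2 * a * b, a\<^sup>2 + 2 * b, - 2 * a, 1:] * G" .
  have dvd: "\<not> 5 dvd 5 * m + 1" "\<not> 5 dvd 5 * m + 2" "\<not> 5 dvd 5 * m + 3" "\<not> 5 dvd 5 * m + 4"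
    by presburger+
  have dvd': "\<not> 5 dvd 5 * m - 1"
    using m(2) by presburger
  have e1: "M + 1 = (5 * m - 1) + 4" "M + 2 = 5 * m + 4"
    using m(2) by (simp_all add: M_def)
  have e2: "5 * m - 1 + 4 = 5 * m + 3" "5 * m - 1 + 3 = 5 * m + 2" "5 * m - 1 + 2 = 5 * m + 1" "5 * m - 1 + 1 = 5 * m"
    using m(2) by simp_all
  have "Polynomial.coeff G (5 * m - 1 + 4) = 0" "Polynomial.coeff G (5 * m - 1 + 3) = 0"
    "Polynomial.coeff G (5 * m - 1 + 2) = 0" "Polynomial.coeff G (5 * m - 1 + 1) = \<gamma>"
    "Polynomial.coeff G (5 * m - 1) = 0"
    unfolding e2 \<gamma>_def unfolding G using dvd dvd' by (simp_all only: if_False)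
  then have "Polynomial.coeff ([:b, - a, 1:] ^ M) (M + 1) = - 2 * a * \<gamma>"
    unfolding S e1(1) coeff_mult_quartic by simp
  moreover have "Polynomial.coeff ([:b, - a, 1:] ^ M) (M + 2) = \<gamma>"
  proof -
    have "Polynomial.coeff G (5 * m + 4) = 0" "Polynomial.coeff G (5 * m + 3) = 0"
      "Polynomial.coeff G (5 * m + 2) = 0" "Polynomial.coeff G (5 * m + 1) = 0"
      unfolding G using dvd by (simp_all only: if_False)
    then show ?thesis
      unfolding S e1(2) coeff_mult_quartic \<gamma>_def by simp
  qed
  moreover have "Polynomial.coeff ([:b, - a, 1:] ^ M) 1 = - 2 * a * b * (b ^ m) ^ 5"
    unfolding S coeff_mult_quartic G0 by (simp add: G)
  moreover have "Polynomial.coeff ([:b, - a, 1:] ^ M) 2 = (a\<^sup>2 + 2 * b) * (b ^ m) ^ 5"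
    unfolding S coeff_mult_quartic G0 by (simp add: G)
  moreover have "1 < M" "2 < M"
    using m(2) by (simp_all add: M_def)
  ultimately have "- 2 * a * b * (b ^ m) ^ 5 + - 2 * a * \<gamma> = 0" "(a\<^sup>2 + 2 * b) * (b ^ m) ^ 5 + \<gamma> = 0"
    using char_5_coeffs[OF assms(1,2) M, of 1] char_5_coeffs[OF assms(1,2) M, of 2] by simp_all
  \<comment> \<open>Eliminating \<open>\<gamma>\<close> from the two relations leaves a^2 + b, which
    is a^2 - 4b in characteristic 5.\<close>
  moreover have "- 2 * a * ((b ^ m) ^ 5 * (a\<^sup>2 + b)) =
    - 2 * a * ((a\<^sup>2 + 2 * b) * (b ^ m) ^ 5 + \<gamma>) - (- 2 * a * b * (b ^ m) ^ 5 + - 2 * a * \<gamma>)"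
    by algebra
  ultimately have "- 2 * a * ((b ^ m) ^ 5 * (a\<^sup>2 + b)) = 0"
    by simp
  moreover have "(2::'a) \<noteq> 0"
    by (rule numeral_neq_0_CHAR) (use assms(1) in auto)
  ultimately have "a\<^sup>2 + b = 0"
    using assms(2) b_nz by simp
  moreover have "a\<^sup>2 - 4 * b = (a\<^sup>2 + b) - 5 * b"
    by algebra
  ultimately show ?thesis
    unfolding five by simp
qed

end

section \<open>Reduction to the subfield\<close>

locale quadratic_extension = finite_subfield K q for K :: "'a::finite_field set" and q +
  fixes \<alpha> :: 'a
  assumes card_whole: "card (UNIV :: 'a set) = q\<^sup>2"
    and q_power: "\<exists>n. q = CHAR('a) ^ n"
    and \<alpha>_nz: "\<alpha> \<noteq> 0"
begin

sublocale whole: finite_subfield "UNIV :: 'a set" "q\<^sup>2"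
  by standard (simp_all add: is_subfield_def card_whole)

lemma frobenius_add: "(x + y :: 'a) ^ q = x ^ q + y ^ q"
  using freshmans_dream'[of q] q_power CHAR_prime by blast

lemma frobenius_twice: "(x ^ q) ^ q = (x :: 'a)"
  using whole.power_q[of x] by (simp add: power2_eq_square power_mult)

lemma norm_mem: "x ^ (q + 1) \<in> K"
  unfolding mem_iff by (simp add: power_mult_distrib frobenius_twice mult.commute)

lemma trace_mem: "x + x ^ q \<in> K"
  unfolding mem_iff by (simp add: frobenius_add frobenius_twice add.commute)

text \<open>Root extraction with d = q + 1 in the big field: the required power of y is y^(q-1),
  which is 1 for nonzero y in \<open>K\<close>.\<close>

lemma norm_surj:
  assumes "y \<in> K"
  obtains x where "x ^ (q + 1) = y"
proof (cases "y = 0")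
  case False
  have eq: "q\<^sup>2 - 1 = (q + 1) * (q - 1)"
    using q_ge_2 by (simp add: power2_eq_square algebra_simps)
  have "(q\<^sup>2 - 1) div (q + 1) = q - 1"
    unfolding eq by (rule nonzero_mult_div_cancel_left) simp
  then have "y ^ ((q\<^sup>2 - 1) div (q + 1)) = 1"
    using power_units assms False by simp
  moreover have "q + 1 dvd q\<^sup>2 - 1"
    unfolding eq by (rule dvd_triv_left)
  ultimately obtain x where "x ^ (q + 1) = y"
    using whole.ex_root[of "q + 1" y] False by blast
  then show ?thesis
    by (rule that)
qed (use that[of 0] in simp)

lemma power_split: "x ^ (2 * q + 3) = x * (x ^ (q + 1))\<^sup>2" for x :: 'a
proof -
  have "2 * q + 3 = Suc ((q + 1) * 2)"
    by simp
  then show ?thesis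
    by (simp only: power_Suc power_mult)
qed

definition nrm :: 'a where "nrm = \<alpha> ^ (q + 1)"
definition trc :: 'a where "trc = \<alpha> + \<alpha> ^ q"
text \<open>Norm and trace become \<alpha>^2 u and \<alpha> (1 + u), so a linear relation between
  T^2 and N is one between (1 + u)^2 and u.\<close>

definition u :: 'a where "u = \<alpha> ^ (q - 1)"

definition reduct :: "'a \<Rightarrow> 'a \<Rightarrow> 'a" where
  "reduct \<beta> y = nrm * y ^ 5 + trc * \<beta> * y ^ 3 + \<beta>\<^sup>2 * y"

lemma nrm_mem [simp]: "nrm \<in> K" and trc_mem [simp]: "trc \<in> K"
  by (simp_all only: nrm_def trc_def norm_mem trace_mem)

lemma nrm_nz [simp]: "nrm \<noteq> 0" and u_nz [simp]: "u \<noteq> 0"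
  using \<alpha>_nz by (simp_all add: nrm_def u_def)

lemma power_q_eq: "\<alpha> ^ q = \<alpha> * u"
  unfolding u_def using q_ge_2 by (metis Suc_diff_1 less_le_trans pos2 power_Suc)

lemma nrm_eq: "nrm = \<alpha>\<^sup>2 * u" and trc_eq: "trc = \<alpha> * (1 + u)"
  by (simp_all add: nrm_def trc_def power_q_eq power2_eq_square distrib_left)

lemma u_eq_1_iff: "u = 1 \<longleftrightarrow> \<alpha> \<in> K"
  unfolding mem_iff power_q_eq using \<alpha>_nz by simp

lemma trc_eq_0_iff: "trc = 0 \<longleftrightarrow> u = - 1"
  unfolding trc_eq using \<alpha>_nz by (simp add: add_eq_0_iff eq_commute[of u])

lemma trc_sq_iff: "c * trc\<^sup>2 = d * nrm \<longleftrightarrow> c * (1 + u)\<^sup>2 = d * u"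
proof -
  have "c * trc\<^sup>2 - d * nrm = \<alpha>\<^sup>2 * (c * (1 + u)\<^sup>2 - d * u)"
    unfolding nrm_eq trc_eq by algebra
  then show ?thesis
    using \<alpha>_nz by (metis mult_eq_0_iff power_not_zero right_minus_eq)
qed

lemma trc_sq_eq_5_nrm: "trc\<^sup>2 = 5 * nrm \<longleftrightarrow> u\<^sup>2 - 3 * u + 1 = 0"
proof -
  have "trc\<^sup>2 = 5 * nrm \<longleftrightarrow> (1 + u)\<^sup>2 = 5 * u"
    using trc_sq_iff[of 1 5] by simp
  also have "\<dots> \<longleftrightarrow> (1 + u)\<^sup>2 - 5 * u = 0"
    by simp
  also have "(1 + u)\<^sup>2 - 5 * u = u\<^sup>2 - 3 * u + 1"
    by algebra
  finally show ?thesis .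
qed

lemma reduct_mem: "\<beta> \<in> K \<Longrightarrow> y \<in> K \<Longrightarrow> reduct \<beta> y \<in> K"
  by (simp add: reduct_def)

lemma norm_of_value:
  assumes "\<beta> \<in> K"
  shows "(\<alpha> * x ^ (2 * q + 3) + \<beta> * x) ^ (q + 1) = reduct \<beta> (x ^ (q + 1))"
proof -
  define n where "n = x ^ (q + 1)"
  have n: "n ^ q = n"
    using norm_mem[of x] by (simp only: mem_iff n_def)
  have "\<alpha> * x ^ (2 * q + 3) + \<beta> * x = x * (\<alpha> * n\<^sup>2 + \<beta>)"
    unfolding power_split n_def by (simp add: distrib_left mult_ac)
  then have "(\<alpha> * x ^ (2 * q + 3) + \<beta> * x) ^ (q + 1) = n * ((\<alpha> * n\<^sup>2 + \<beta>) * (\<alpha> * n\<^sup>2 + \<beta>) ^ q)"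
    by (simp add: n_def power_mult_distrib mult_ac)
  also have "(\<alpha> * n\<^sup>2 + \<beta>) ^ q = \<alpha> ^ q * n\<^sup>2 + \<beta>"
    using power_q[OF assms] n by (simp add: frobenius_add power_mult_distrib mult.commute[of 2 q] flip: power_mult)
      (simp add: power_mult mult.commute)
  also have "n * ((\<alpha> * n\<^sup>2 + \<beta>) * (\<alpha> ^ q * n\<^sup>2 + \<beta>)) = reduct \<beta> n"
    unfolding reduct_def nrm_eq trc_eq power_q_eq by algebra
  finally show ?thesis
    by (simp only: n_def)
qed

text \<open>The polynomial commutes with multiplication by elements of norm 1, and on the big field
  the norm identifies exactly the orbits of these elements; hence injectivity upstairs and
  downstairs correspond.\<close>

lemma permutation_iff:
  assumes "\<beta> \<in> K"
  shows "bij (\<lambda>x. \<alpha> * x ^ (2 * q + 3) + \<beta> * x) \<longleftrightarrow> inj_on (reduct \<beta>) K"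
proof
  let ?f = "\<lambda>x. \<alpha> * x ^ (2 * q + 3) + \<beta> * x"
  have f_eq: "?f x = x * (\<alpha> * (x ^ (q + 1))\<^sup>2 + \<beta>)" for x
    unfolding power_split by (simp add: distrib_left mult_ac)
  {
    assume inj: "inj_on (reduct \<beta>) K"
    have "inj ?f"
    proof (rule injI)
      fix x y assume xy: "?f x = ?f y"
      then have "reduct \<beta> (x ^ (q + 1)) = reduct \<beta> (y ^ (q + 1))"
        by (simp only: norm_of_value[OF assms, symmetric])
      then have n: "x ^ (q + 1) = y ^ (q + 1)"
        using inj_onD[OF inj] norm_mem by blast
      show "x = y"
      proof (cases "x = 0")
        case True
        then show ?thesis
          using n by auto
      next
        case False
        \<comment> \<open>This makes the common factor \<alpha> n^2 + \<beta> nonzero, so it can be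
          cancelled.\<close>
        have "reduct \<beta> (x ^ (q + 1)) \<noteq> reduct \<beta> 0"
          using inj_onD[OF inj _ norm_mem zero_mem, of x] False by auto
        then have "?f x \<noteq> 0"
          unfolding norm_of_value[OF assms, symmetric] by (auto simp: reduct_def)
        then show ?thesis
          using xy unfolding f_eq n by auto
      qed
    qed
    then show "bij ?f"
      by (simp add: bij_def finite_UNIV_inj_surj)
  }
  {
    assume "bij ?f"
    then have inj: "inj ?f"
      by (rule bij_is_inj)
    show "inj_on (reduct \<beta>) K"
    proof (rule inj_onI)
      fix m n assume m: "m \<in> K" and n: "n \<in> K" and mn: "reduct \<beta> m = reduct \<beta> n"
      obtain x where x: "x ^ (q + 1) = m"
        using norm_surj[OF m] .
      obtain y where y: "y ^ (q + 1) = n"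
        using norm_surj[OF n] .
      have norms: "?f x ^ (q + 1) = ?f y ^ (q + 1)"
        using mn unfolding norm_of_value[OF assms] x y .
      show "m = n"
      proof (cases "?f x = 0")
        case True
        then have "?f y = 0"
          using norms by auto
        with True have "?f x = ?f y"
          by simp
        then have "x = y"
          using inj by (rule injD[rotated])
        then show ?thesis
          using x y by simp
      next
        case False
        define z where "z = ?f y / ?f x"
        have z: "z ^ (q + 1) = 1" "z * ?f x = ?f y"
        proof -
          show "z ^ (q + 1) = 1"
            unfolding z_def power_divide norms[symmetric] by (rule divide_self[OF power_not_zero[OF False]])
          show "z * ?f x = ?f y"
            using False by (simp add: z_def)
        qed
        have "?f (z * x) = z * ?f x"
          unfolding f_eq unfolding power_mult_distrib z(1) by simp
        then have "?f (z * x) = ?f y"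
          using z(2) by simp
        then have "z * x = y"
          using inj by (rule injD[rotated])
        then have "n = (z * x) ^ (q + 1)"
          using y by simp
        then show ?thesis
          unfolding power_mult_distrib z(1) x by simp
      qed
    qed
  }
qed

lemma permuting_quintic_reduct:
  assumes "inj_on (reduct \<beta>) K" "\<beta> \<in> K" "\<beta> \<noteq> 0"
  shows "permuting_quintic K q (trc * \<beta> / nrm) (\<beta>\<^sup>2 / nrm)"
proof
  let ?f = "\<lambda>y. y ^ 5 + trc * \<beta> / nrm * y ^ 3 + \<beta>\<^sup>2 / nrm * y"
  have f: "?f = (\<lambda>y. reduct \<beta> y / nrm)"
    by (auto simp: reduct_def add_divide_distrib)
  have "inj_on ?f K"
    unfolding f using assms(1) by (auto simp: inj_on_def)
  moreover have "?f ` K \<subseteq> K"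
    unfolding f using reduct_mem[OF assms(2)] by auto
  ultimately show "bij_betw ?f K K"
    by (simp add: bij_betw_def endo_inj_surj)
qed (use q_power assms in auto)

text \<open>
  The roots of \<open>X\<^sup>2 - 3 X + 1\<close> are the squares of the roots of \<open>X\<^sup>2 + X - 1\<close>, and \<open>u\<close> is one of them; it is
  not in \<open>K\<close>, since its norm is 1 but \<open>u \<noteq> 1, -1\<close>.
\<close>
lemma no_golden_ratio:
  assumes "trc\<^sup>2 = 5 * nrm" "(5::'a) \<noteq> 0" "t \<in> K"
  shows "t\<^sup>2 - 3 * t + 1 \<noteq> 0" "t\<^sup>2 + t - 1 \<noteq> 0"
proof -
  have u2: "u\<^sup>2 - 3 * u + 1 = 0"
    using assms(1) trc_sq_eq_5_nrm by simp
  have "u ^ (q + 1) = (\<alpha> ^ (q + 1)) ^ (q - 1)"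
    unfolding u_def by (simp only: mult.commute flip: power_mult)
  also have "\<dots> = 1"
    using power_units[OF norm_mem, of \<alpha>] \<alpha>_nz by simp
  finally have norm_u: "u ^ (q + 1) = 1" .
  have "u \<notin> K"
  proof
    assume "u \<in> K"
    then have "u * u = 1"
      using norm_u by (simp add: mem_iff)
    then have "u = 1 \<or> u = - 1"
      by (simp add: square_eq_1_iff)
    then show False
      using u2 assms(2) by auto
  qed
  moreover have "t = u \<or> t = 3 - u" if "t\<^sup>2 - 3 * t + 1 = 0" for t
  proof -
    have "(t - u) * (t - (3 - u)) = (t\<^sup>2 - 3 * t + 1) - (u\<^sup>2 - 3 * u + 1)"
      by algebra
    then have "(t - u) * (t - (3 - u)) = 0"
      unfolding that u2 by simp
    then show ?thesis
      by auto
  qed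
  moreover have "u = 3 - (3 - u)"
    by simp
  ultimately have no: "t\<^sup>2 - 3 * t + 1 \<noteq> 0" if "t \<in> K" for t
    using that by (metis diff_mem numeral_mem)
  show "t\<^sup>2 - 3 * t + 1 \<noteq> 0"
    using no[OF assms(3)] .
  have "(t\<^sup>2)\<^sup>2 - 3 * t\<^sup>2 + 1 = (t\<^sup>2 + t - 1) * (t\<^sup>2 - t - 1)"
    by algebra
  then show "t\<^sup>2 + t - 1 \<noteq> 0"
    using no[of "t\<^sup>2"] assms(3) by auto
qed

text \<open>After division by N the quintic is y^5 + 5c y^3 + 5c^2 y, the Dickson polynomial of
  degree 5 with parameter -c.\<close>

lemma inj_if_dickson:
  assumes "trc\<^sup>2 = 5 * nrm" "(5::'a) \<noteq> 0" "\<beta> \<in> K"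
  shows "inj_on (reduct \<beta>) K"
proof (rule inj_onI, rule ccontr)
  fix y z assume yz: "y \<in> K" "z \<in> K" "reduct \<beta> y = reduct \<beta> z" "y \<noteq> z"
  define c where "c = trc * \<beta> / (5 * nrm)"
  have c: "c \<in> K" "trc * \<beta> = 5 * c * nrm" "\<beta>\<^sup>2 = 5 * c\<^sup>2 * nrm"
  proof -
    show "c \<in> K"
      using assms by (simp add: c_def)
    show "trc * \<beta> = 5 * c * nrm"
      using assms by (simp add: c_def)
    then have "5 * nrm * \<beta>\<^sup>2 = (5 * c * nrm)\<^sup>2"
      unfolding assms(1)[symmetric] by (simp flip: power_mult_distrib)
    also have "\<dots> = 5 * nrm * (5 * c\<^sup>2 * nrm)"
      by algebra
    finally show "\<beta>\<^sup>2 = 5 * c\<^sup>2 * nrm"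
      using assms(2) by (metis mult_cancel_left mult_eq_0_iff nrm_nz)
  qed
  define A where "A = y\<^sup>2 + z\<^sup>2 + 3 * c"
  define B where "B = y * z - c"
  have AB: "A \<in> K" "B \<in> K"
    using yz c by (simp_all add: A_def B_def)
  \<comment> \<open>\<open>A\<^sup>2 + A B - B\<^sup>2\<close> is the norm of \<open>A + B \<phi>\<close>, where \<open>\<phi>\<close> is the golden ratio.\<close>
  have "reduct \<beta> y - reduct \<beta> z = nrm * (y - z) * (A\<^sup>2 + A * B - B\<^sup>2)"
    unfolding reduct_def c(2,3) A_def B_def by algebra
  then have 0: "A\<^sup>2 + A * B - B\<^sup>2 = 0"
    using yz by simp
  have "B = 0"
  proof (rule ccontr)
    assume "B \<noteq> 0"
    then have "(A / B)\<^sup>2 + A / B - 1 = (A\<^sup>2 + A * B - B\<^sup>2) / B\<^sup>2"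
      by (simp add: field_simps power2_eq_square)
    then show False
      using no_golden_ratio(2)[OF assms(1,2), of "A / B"] AB 0 by simp
  qed
  then have "A = 0"
    using 0 by simp
  \<comment> \<open>This combination eliminates c, so -y/z would be a root of X^2 - 3X + 1.\<close>
  have "y\<^sup>2 + 3 * (y * z) + z\<^sup>2 = A + 3 * B"
    by (simp add: A_def B_def)
  then have 1: "y\<^sup>2 + 3 * (y * z) + z\<^sup>2 = 0"
    using \<open>A = 0\<close> \<open>B = 0\<close> by simp
  have "z \<noteq> 0"
    using 1 yz by auto
  then have "(- (y / z))\<^sup>2 - 3 * (- (y / z)) + 1 = (y\<^sup>2 + 3 * (y * z) + z\<^sup>2) / z\<^sup>2"
    by (simp add: field_simps power2_eq_square)
  then show False
    using no_golden_ratio(1)[OF assms(1,2), of "- (y / z)"] yz 1 by simp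
qed

lemma CHAR_dvd_q: "CHAR('a) dvd q"
  using of_nat_q by (simp only: of_nat_eq_0_iff_char_dvd)

lemma CHAR_eq_5: "CHAR('a) = 5" if "q mod 5 = 0"
proof -
  obtain n where n: "q = CHAR('a) ^ n"
    using q_power by blast
  have "5 dvd CHAR('a) ^ n"
    using that unfolding n by (simp add: dvd_eq_mod_eq_0)
  then have "5 dvd CHAR('a)"
    by (rule prime_dvd_power[rotated]) simp
  then show ?thesis
    using primes_dvd_imp_eq[of 5 "CHAR('a)"] by simp
qed

lemma five_neq_0: "(5::'a) \<noteq> 0" if "q mod 5 \<noteq> 0"
proof
  assume "(5::'a) = 0"
  then have "CHAR('a) = 5"
    by (simp add: numeral_eq_0_iff_CHAR primes_dvd_imp_eq)
  then show False
    using CHAR_dvd_q that by (simp add: dvd_eq_mod_eq_0)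
qed

text \<open>The exceptional quintics over nine elements do not arise here: a = 0 forces u = -1 and
  thus N^4 = \<alpha>^8 = -1, while b^2 = -1 forces N^4 = \<beta>^8 = 1.\<close>

lemma q_mod_5_neq_1_4:
  assumes "inj_on (reduct \<beta>) K" "\<beta> \<in> K" "\<beta> \<noteq> 0"
  shows "q mod 5 \<noteq> 1" "q mod 5 \<noteq> 4"
proof -
  interpret permuting_quintic K q "trc * \<beta> / nrm" "\<beta>\<^sup>2 / nrm"
    using permuting_quintic_reduct[OF assms] .
  show "q mod 5 \<noteq> 1"
    by (rule q_mod_5_neq_1)
  show "q mod 5 \<noteq> 4"
  proof
    assume "q mod 5 = 4"
    then have q: "q = 9" and a: "trc * \<beta> / nrm = 0" and b: "(\<beta>\<^sup>2 / nrm)\<^sup>2 = - 1"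
      using mod_5_eq_4 by auto
    have "u = - 1"
      using a assms(3) trc_eq_0_iff by simp
    then have "nrm = - \<alpha>\<^sup>2"
      by (simp add: nrm_eq)
    then have "(nrm\<^sup>2)\<^sup>2 = \<alpha> ^ 8"
      by (simp flip: power_mult)
    also have "\<alpha> ^ 8 = - 1"
      using \<open>u = - 1\<close> unfolding u_def using q by simp
    finally have "(nrm\<^sup>2)\<^sup>2 = - 1" .
    moreover have "(\<beta>\<^sup>2)\<^sup>2 = - nrm\<^sup>2"
      using b by (simp add: power_divide divide_eq_eq)
    then have "(nrm\<^sup>2)\<^sup>2 = \<beta> ^ 8"
      by (metis power2_minus power_mult mult_2 numeral_Bit0)
    moreover have "\<beta> ^ 8 = 1"
      using power_units[OF assms(2,3)] q by simp
    ultimately have "(2::'a) = 0"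
      by (metis one_add_one add.right_inverse)
    then have "CHAR('a) = 2"
      by (simp add: numeral_eq_0_iff_CHAR primes_dvd_imp_eq)
    then show False
      using CHAR_dvd_q q by simp
  qed
qed

lemma inj_reduct_imp:
  assumes "inj_on (reduct \<beta>) K" "\<beta> \<in> K" "\<beta> \<noteq> 0" "q mod 5 = 2 \<or> q mod 5 = 3" "q \<noteq> 3"
  shows "trc\<^sup>2 = 5 * nrm \<or> q = 13 \<and> 2 * trc\<^sup>2 = 5 * nrm"
proof (cases "q = 2")
  case True
  \<comment> \<open>Over two elements N = \<beta> = 1, and injectivity forces T = 1; since 5 = 1,
    the relation holds.\<close>
  have two: "(2::'a) = 0"
    using of_nat_q True by simp
  have 01: "x = 0 \<or> x = 1" if "x \<in> K" for x
  proof (rule ccontr)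
    assume "\<not> ?thesis"
    then have "card {0, 1, x} = 3"
      by auto
    moreover have "card {0, 1, x} \<le> card K"
      using that by (intro card_mono) auto
    ultimately show False
      by (simp add: card_K True)
  qed
  then have "nrm = 1" "\<beta> = 1"
    using nrm_nz assms by (metis nrm_mem)+
  then have "reduct \<beta> 1 = trc + 2"
    by (simp add: reduct_def)
  then have "reduct \<beta> 1 = trc"
    using two by simp
  moreover have "reduct \<beta> 1 \<noteq> reduct \<beta> 0"
    using inj_onD[OF assms(1), of 1 0] by auto
  ultimately have "trc = 1"
    using 01[OF trc_mem] by (simp add: reduct_def)
  moreover have "(5::'a) = 1 + 2 * 2"
    by simp
  then have "(5::'a) = 1"
    unfolding two by simp
  ultimately show ?thesis
    using \<open>nrm = 1\<close> by simp
next
  case False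
  interpret permuting_quintic K q "trc * \<beta> / nrm" "\<beta>\<^sup>2 / nrm"
    using permuting_quintic_reduct[OF assms(1-3)] .
  have "(trc * \<beta> / nrm)\<^sup>2 = 5 * (\<beta>\<^sup>2 / nrm) \<or> q = 13 \<and> 2 * (trc * \<beta> / nrm)\<^sup>2 = 5 * (\<beta>\<^sup>2 / nrm)"
    using mod_5_eq_2 mod_5_eq_3 False assms(4,5) by blast
  moreover have "c * trc\<^sup>2 = 5 * nrm" if "c * (trc * \<beta> / nrm)\<^sup>2 = 5 * (\<beta>\<^sup>2 / nrm)" for c
  proof -
    have "\<beta>\<^sup>2 * (c * trc\<^sup>2) = nrm\<^sup>2 * (c * (trc * \<beta> / nrm)\<^sup>2)"
      by (simp add: field_simps)
    also have "\<dots> = nrm\<^sup>2 * (5 * (\<beta>\<^sup>2 / nrm))"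
      by (simp only: that)
    also have "\<dots> = \<beta>\<^sup>2 * (5 * nrm)"
      by (simp add: power2_eq_square)
    finally show ?thesis
      using assms(3) by (metis mult_cancel_left power_not_zero)
  qed
  note this[of 1] this[of 2]
  ultimately show ?thesis
    by auto
qed

section \<open>Injectivity of the reduced quintic in characteristic 5\<close>

lemma char_5_half:
  assumes "CHAR('a) = 5"
  obtains M where "q - 1 = 2 * M" "even M" "(q - 1) div 2 = M" "M > 0"
proof -
  obtain n where n: "q = 5 ^ n"
    using q_power assms by auto
  have "q mod 4 \<in> {1}"
    unfolding n by (rule power_mod_cycle) auto
  then have "q = 4 * (q div 4) + 1"
    using mult_div_mod_eq[of 4 q] by simp
  moreover from this have "q div 4 > 0"
    using q_ge_2 by (intro Nat.gr0I) auto
  ultimately show ?thesis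
    by (intro that[of "2 * (q div 4)"]) auto
qed

lemma square_or_minus_1:
  assumes "q - 1 = 2 * M" "x \<in> K" "x \<noteq> 0"
  shows "x ^ M = 1 \<or> x ^ M = - 1"
proof -
  have "(x ^ M)\<^sup>2 = 1"
    using power_units[OF assms(2,3)] assms(1) by (simp add: mult.commute flip: power_mult)
  then show ?thesis
    by (simp add: power2_eq_1_iff)
qed

text \<open>For u = 1 the quintic is y (\<alpha> y^2 + \<beta>)^2, so -\<beta>/\<alpha> must be a
  nonsquare; the sign drops out because (q - 1) / 2 is even.\<close>

lemma nonsquare_condition:
  assumes "CHAR('a) = 5" "u = 1" "inj_on (reduct \<beta>) K" "\<beta> \<in> K" "\<beta> \<noteq> 0"
  shows "\<beta> ^ ((q - 1) div 2) = - (\<alpha> ^ ((q - 1) div 2))"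
proof -
  obtain M where M: "q - 1 = 2 * M" "even M" "(q - 1) div 2 = M" "M > 0"
    using char_5_half[OF assms(1)] .
  have \<alpha>: "\<alpha> \<in> K"
    using assms(2) u_eq_1_iff by simp
  define e where "e = - \<beta> / \<alpha>"
  have e: "e \<in> K" "e \<noteq> 0" "\<alpha> * e = - \<beta>"
    using \<alpha> assms(4,5) \<alpha>_nz by (simp_all add: e_def)
  have dvd: "2 dvd q - 1"
    unfolding M(1) by simp
  have "e ^ M \<noteq> 1"
  proof
    assume "e ^ M = 1"
    then obtain y where y: "y \<in> K" "y \<noteq> 0" "y\<^sup>2 = e"
      using ex_root[of 2 e] e(1,2) M(3) dvd by auto
    have "reduct \<beta> y = y * (\<alpha> * y\<^sup>2 + \<beta>)\<^sup>2"
      unfolding reduct_def nrm_eq trc_eq assms(2) by algebra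
    also have "\<dots> = reduct \<beta> 0"
      unfolding y e(3) by (simp add: reduct_def)
    finally show False
      using inj_onD[OF assms(3) _ y(1) zero_mem] y(2) by simp
  qed
  then have "e ^ M = - 1"
    using square_or_minus_1[OF M(1) e(1,2)] by simp
  then have "\<alpha> ^ M * - 1 = (- \<beta>) ^ M"
    unfolding e(3)[symmetric] by (simp add: power_mult_distrib)
  then show ?thesis
    using M by (simp add: power_minus_even)
qed

text \<open>For nonzero \<beta> and T, the relation a^2 = 4b reads T^2 = 4N, that is (u - 1)^2 =
  0.\<close>

lemma char_5_imp:
  assumes "CHAR('a) = 5" "q \<noteq> 5" "inj_on (reduct \<beta>) K" "\<beta> \<in> K"
  shows "u = - 1 \<or> \<beta> ^ ((q - 1) div 2) \<in> {0, - (\<alpha> ^ ((q - 1) div 2))}"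
proof -
  obtain M where M: "q - 1 = 2 * M" "even M" "(q - 1) div 2 = M" "M > 0"
    using char_5_half[OF assms(1)] .
  consider "\<beta> = 0" | "trc = 0" | "\<beta> \<noteq> 0" "trc \<noteq> 0"
    by blast
  then show ?thesis
  proof cases
    case 1
    then show ?thesis
      using M by simp
  next
    case 2
    then show ?thesis
      using trc_eq_0_iff by simp
  next
    case 3
    interpret permuting_quintic K q "trc * \<beta> / nrm" "\<beta>\<^sup>2 / nrm"
      using permuting_quintic_reduct[OF assms(3,4) 3(1)] .
    have a: "(trc * \<beta> / nrm)\<^sup>2 = 4 * (\<beta>\<^sup>2 / nrm)"
      using char_5 assms(1,2) 3 by simp
    have "\<beta>\<^sup>2 * trc\<^sup>2 = nrm\<^sup>2 * (trc * \<beta> / nrm)\<^sup>2"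
      by (simp add: field_simps)
    also have "\<dots> = \<beta>\<^sup>2 * (4 * nrm)"
      unfolding a by (simp add: power2_eq_square)
    finally have "1 * trc\<^sup>2 = 4 * nrm"
      using 3(1) by simp
    then have "1 * (1 + u)\<^sup>2 = 4 * u"
      unfolding trc_sq_iff .
    moreover have "(u - 1)\<^sup>2 = 1 * (1 + u)\<^sup>2 - 4 * u"
      by algebra
    ultimately have "u = 1"
      by simp
    then show ?thesis
      using nonsquare_condition assms 3 by simp
  qed
qed

text \<open>Here T = 0 and the quintic is additive. A nonzero h in its kernel would give \<alpha> =
  \<beta>/h^2 or -\<beta>/h^2, hence \<alpha> in \<open>K\<close>, against u = -1.\<close>

lemma inj_if_u_eq_minus_1:
  assumes "CHAR('a) = 5" "u = - 1" "\<beta> \<in> K"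
  shows "inj_on (reduct \<beta>) K"
proof (rule inj_onI, rule ccontr)
  have five: "(5::'a) = 0"
    using assms(1) by (simp add: numeral_eq_0_iff_CHAR)
  fix y z assume yz: "y \<in> K" "z \<in> K" "reduct \<beta> y = reduct \<beta> z" "y \<noteq> z"
  define h where "h = y - z"
  have h: "h \<in> K" "h \<noteq> 0" "y = z + h"
    using yz by (simp_all add: h_def)
  have "reduct \<beta> y - reduct \<beta> z = h * (\<beta> - \<alpha> * h\<^sup>2) * (\<beta> + \<alpha> * h\<^sup>2)
      - 5 * (\<alpha>\<^sup>2 * (z ^ 4 * h + 2 * z ^ 3 * h\<^sup>2 + 2 * z\<^sup>2 * h ^ 3 + z * h ^ 4))"
    unfolding reduct_def nrm_eq trc_eq assms(2) h(3) by algebra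
  then have "\<beta> - \<alpha> * h\<^sup>2 = 0 \<or> \<beta> + \<alpha> * h\<^sup>2 = 0"
    unfolding five using yz(3) h(2) by simp
  then have "\<alpha> = \<beta> / h\<^sup>2 \<or> \<alpha> = - \<beta> / h\<^sup>2"
    using h(2) by (auto simp: field_simps eq_neg_iff_add_eq_0)
  then have "\<alpha> \<in> K"
    using assms(3) h(1) by auto
  then have "(2::'a) = 0"
    using assms(2) u_eq_1_iff by (metis one_add_one add.right_inverse)
  then show False
    using assms(1) by (simp add: numeral_eq_0_iff_CHAR)
qed

lemma inj_if_nonsquare:
  assumes "CHAR('a) = 5" "\<alpha> \<in> K" "\<beta> \<in> K"
    and "\<beta> ^ ((q - 1) div 2) \<in> {0, - (\<alpha> ^ ((q - 1) div 2))}"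
  shows "inj_on (reduct \<beta>) K"
proof (rule inj_onI, rule ccontr)
  have five: "(5::'a) = 0"
    using assms(1) by (simp add: numeral_eq_0_iff_CHAR)
  have u: "u = 1"
    using assms(2) u_eq_1_iff by simp
  obtain M where M: "q - 1 = 2 * M" "even M" "(q - 1) div 2 = M" "M > 0"
    using char_5_half[OF assms(1)] .
  fix y z assume yz: "y \<in> K" "z \<in> K" "reduct \<beta> y = reduct \<beta> z" "y \<noteq> z"
  define h where "h = y - z"
  have h: "h \<in> K" "h \<noteq> 0" "y = z + h"
    using yz by (simp_all add: h_def)
  define e where "e = \<beta> / \<alpha>"
  have e: "e \<in> K" "\<beta> = \<alpha> * e"
    using assms \<alpha>_nz by (simp_all add: e_def)
  \<comment> \<open>In characteristic 5, z + 3h is the midpoint of y and z; using it completes the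
    square in the difference quotient.\<close>
  define w where "w = e * (z + 3 * h)"
  have w: "w \<in> K"
    using yz h e by (simp add: w_def)
  have eq: "e * (reduct \<beta> y - reduct \<beta> z) = \<alpha>\<^sup>2 * h * (w\<^sup>2 + e * (h\<^sup>2 - e)\<^sup>2)
      + 5 * (\<alpha>\<^sup>2 * (e * (z ^ 4 * h + 2 * z ^ 3 * h\<^sup>2 + 2 * z\<^sup>2 * h ^ 3 + z * h ^ 4) + h * e\<^sup>2 * (z\<^sup>2 - h\<^sup>2)))"
    unfolding reduct_def nrm_eq trc_eq u h(3) e(2) w_def by algebra
  have "\<alpha>\<^sup>2 * h * (w\<^sup>2 + e * (h\<^sup>2 - e)\<^sup>2) = 0"
    using eq yz(3) unfolding five by simp
  then have w2: "w\<^sup>2 + e * (h\<^sup>2 - e)\<^sup>2 = 0"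
    using h(2) \<alpha>_nz by simp
  \<comment> \<open>The identity was multiplied by e, so this case is separate: the quintic is then
    \<alpha>^2 x^5, a multiple of Frobenius.\<close>
  have "e \<noteq> 0"
  proof
    assume "e = 0"
    then have "reduct \<beta> x = \<alpha>\<^sup>2 * x ^ 5" for x
      by (simp add: reduct_def nrm_eq u e(2))
    then have "reduct \<beta> y - reduct \<beta> z = \<alpha>\<^sup>2 * (z + h) ^ 5 - \<alpha>\<^sup>2 * z ^ 5"
      by (simp only: h(3))
    also have "\<dots> = \<alpha>\<^sup>2 * h ^ 5 + 5 * (\<alpha>\<^sup>2 * (z ^ 4 * h + 2 * z ^ 3 * h\<^sup>2 + 2 * z\<^sup>2 * h ^ 3 + z * h ^ 4))"
      by algebra
    finally have "reduct \<beta> y - reduct \<beta> z = \<dots>" .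
    then show False
      using yz(3) h(2) \<alpha>_nz unfolding five by simp
  qed
  then have "e ^ M = - 1"
    using assms(4) M(3,4) \<alpha>_nz by (simp add: e(2) power_mult_distrib)
      (metis mult_cancel_left mult_minus1_right power_not_zero)
  moreover have "e ^ M = 1"
  proof (cases "h\<^sup>2 = e")
    case True
    show ?thesis
      using power_units[OF h(1,2)] M(1) by (simp only: True[symmetric] power_mult)
  next
    case False
    define s where "s = w / (h\<^sup>2 - e)"
    have "s \<in> K"
      using w h e by (simp add: s_def)
    have "w\<^sup>2 = - e * (h\<^sup>2 - e)\<^sup>2"
      using w2 by (simp add: eq_neg_iff_add_eq_0)
    then have s: "s\<^sup>2 = - e"
      using False by (simp add: s_def power_divide)
    then have "s \<noteq> 0"
      using \<open>e \<noteq> 0\<close> by auto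
    then have "(- e) ^ M = 1"
      using power_units[OF \<open>s \<in> K\<close>] unfolding s[symmetric] M(1) by (simp add: power_mult)
    then show ?thesis
      using M(2) by (simp add: power_minus_even)
  qed
  ultimately have "(2::'a) = 0"
    by (metis one_add_one add.right_inverse)
  then show False
    using assms(1) by (simp add: numeral_eq_0_iff_CHAR)
qed

lemma dickson_iff: "\<alpha> ^ (2 * q - 2) - 3 * \<alpha> ^ (q - 1) + 1 = 0 \<longleftrightarrow> trc\<^sup>2 = 5 * nrm"
proof -
  have "2 * q - 2 = (q - 1) * 2"
    by simp
  then have "\<alpha> ^ (2 * q - 2) = u\<^sup>2"
    unfolding u_def by (simp only: power_mult)
  then show ?thesis
    unfolding trc_sq_eq_5_nrm by (simp add: u_def)
qed

section \<open>Combining the conditions for \<beta> and \<beta> + 1\<close>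

lemma one_nonzero: "\<exists>\<gamma>\<in>{\<beta>, \<beta> + 1}. \<gamma> \<noteq> (0::'a)"
  by auto

lemma complete_mod_5_1_4:
  assumes "\<beta> \<in> K" "q mod 5 = 1 \<or> q mod 5 = 4"
  shows "\<not> (inj_on (reduct \<beta>) K \<and> inj_on (reduct (\<beta> + 1)) K)"
proof
  assume R: "inj_on (reduct \<beta>) K \<and> inj_on (reduct (\<beta> + 1)) K"
  obtain \<gamma> where "\<gamma> \<in> {\<beta>, \<beta> + 1}" "\<gamma> \<noteq> 0"
    using one_nonzero by blast
  moreover from this have "inj_on (reduct \<gamma>) K" "\<gamma> \<in> K"
    using R assms(1) by auto
  ultimately show False
    using q_mod_5_neq_1_4 assms(2) by blast
qed

lemma complete_mod_5_2_3:
  assumes "\<beta> \<in> K" "q mod 5 = 2 \<or> q mod 5 = 3" "q \<noteq> 3" "q \<noteq> 13"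
  shows "inj_on (reduct \<beta>) K \<and> inj_on (reduct (\<beta> + 1)) K \<longleftrightarrow> trc\<^sup>2 = 5 * nrm"
proof
  assume R: "inj_on (reduct \<beta>) K \<and> inj_on (reduct (\<beta> + 1)) K"
  obtain \<gamma> where "\<gamma> \<in> {\<beta>, \<beta> + 1}" "\<gamma> \<noteq> 0"
    using one_nonzero by blast
  moreover from this have "inj_on (reduct \<gamma>) K" "\<gamma> \<in> K"
    using R assms(1) by auto
  ultimately show "trc\<^sup>2 = 5 * nrm"
    using inj_reduct_imp assms(2-4) by blast
next
  assume "trc\<^sup>2 = 5 * nrm"
  moreover have "q mod 5 \<noteq> 0"
    using assms(2) by auto
  ultimately show "inj_on (reduct \<beta>) K \<and> inj_on (reduct (\<beta> + 1)) K"
    using inj_if_dickson five_neq_0 assms(1) by simp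
qed

text \<open>Squaring the condition for the nonzero one of the two parameters gives \<alpha>^(q-1) =
  1, so \<alpha> lies in \<open>K\<close>.\<close>

lemma complete_char_5_if:
  assumes "\<beta> \<in> K" "CHAR('a) = 5"
    and "\<beta> ^ ((q - 1) div 2) \<in> {0, - (\<alpha> ^ ((q - 1) div 2))}"
    and "(\<beta> + 1) ^ ((q - 1) div 2) \<in> {0, - (\<alpha> ^ ((q - 1) div 2))}"
  shows "inj_on (reduct \<beta>) K \<and> inj_on (reduct (\<beta> + 1)) K"
proof -
  obtain M where M: "q - 1 = 2 * M" "even M" "(q - 1) div 2 = M" "M > 0"
    using char_5_half[OF assms(2)] .
  obtain \<gamma> where \<gamma>: "\<gamma> \<in> {\<beta>, \<beta> + 1}" "\<gamma> \<noteq> 0"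
    using one_nonzero by blast
  then have "\<gamma> \<in> K" "\<gamma> ^ M \<in> {0, - (\<alpha> ^ M)}"
    using assms M(3) by auto
  then have "\<gamma> ^ M = - (\<alpha> ^ M)"
    using \<gamma>(2) by auto
  then have "(\<gamma> ^ M)\<^sup>2 = (\<alpha> ^ M)\<^sup>2"
    by simp
  then have "\<alpha> ^ (q - 1) = \<gamma> ^ (q - 1)"
    unfolding M(1) by (simp add: mult.commute flip: power_mult)
  then have "u = 1"
    using power_units[OF \<open>\<gamma> \<in> K\<close> \<gamma>(2)] by (simp add: u_def)
  then show ?thesis
    using inj_if_nonsquare assms by (simp add: u_eq_1_iff)
qed

lemma complete_char_5:
  assumes "\<beta> \<in> K" "CHAR('a) = 5" "q \<noteq> 5"
  shows "inj_on (reduct \<beta>) K \<and> inj_on (reduct (\<beta> + 1)) K \<longleftrightarrow>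
    u = - 1 \<or> \<beta> ^ ((q - 1) div 2) \<in> {0, - (\<alpha> ^ ((q - 1) div 2))} \<and>
      (\<beta> + 1) ^ ((q - 1) div 2) \<in> {0, - (\<alpha> ^ ((q - 1) div 2))}"
    (is "?L \<longleftrightarrow> ?R")
proof
  assume ?L
  then show ?R
    using char_5_imp[OF assms(2,3), of \<beta>] char_5_imp[OF assms(2,3), of "\<beta> + 1"]
      assms(1) add_mem[OF assms(1) one_mem] by blast
next
  assume ?R
  then show ?L
    using inj_if_u_eq_minus_1[OF assms(2)] complete_char_5_if[OF assms(1,2)]
      assms(1) add_mem[OF assms(1) one_mem] by blast
qed

section \<open>Subfields of prime order, and the field with 9 elements\<close>

lemma CHAR_if_prime: "CHAR('a) = q" if "prime q"
  using CHAR_dvd_q that CHAR_prime primes_dvd_imp_eq by blast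

lemma prime_field:
  assumes "prime q" "x \<in> K"
  obtains i where "i < q" "x = of_nat i"
proof -
  have "inj_on (of_nat :: nat \<Rightarrow> 'a) {..<q}"
  proof (rule linorder_inj_onI)
    fix i j assume "i < j" "i \<in> {..<q}" "j \<in> {..<q}"
    moreover from this have "\<not> q dvd j - i"
      by (auto dest: dvd_imp_le)
    ultimately show "of_nat i \<noteq> (of_nat j :: 'a)"
      using of_nat_eq_iff_char_dvd[of i j, where ?'a = 'a] CHAR_if_prime[OF assms(1)] by simp
  qed auto
  then have "card (of_nat ` {..<q} :: 'a set) = card K"
    by (simp add: card_image card_K)
  then have "of_nat ` {..<q} = K"
    by (intro card_subset_eq) auto
  then show ?thesis
    using assms(2) that by auto
qed

text \<open>On three elements y^5 = y^3 = y, so the quintic is linear, and its slope is the norm of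
  \<alpha> + \<beta>.\<close>

lemma inj_reduct_q_3:
  assumes "\<beta> \<in> K" "q = 3"
  shows "inj_on (reduct \<beta>) K \<longleftrightarrow> \<alpha> + \<beta> \<noteq> 0"
proof -
  have r: "reduct \<beta> y = (\<alpha> + \<beta>) ^ (q + 1) * y" if "y \<in> K" for y
  proof -
    have y3: "y ^ 3 = y"
      using power_q[OF that] assms(2) by simp
    have "y ^ 5 = y ^ 3 * y\<^sup>2"
      by algebra
    also have "\<dots> = y * y\<^sup>2"
      by (simp only: y3)
    also have "\<dots> = y ^ 3"
      by algebra
    finally have y5: "y ^ 5 = y"
      by (simp only: y3)
    have "reduct \<beta> y = ((\<alpha> + \<beta>) * (\<alpha> ^ q + \<beta>)) * y"
      unfolding reduct_def y3 y5 nrm_eq trc_eq power_q_eq by algebra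
    also have "\<alpha> ^ q + \<beta> = (\<alpha> + \<beta>) ^ q"
      by (simp add: frobenius_add power_q[OF assms(1)])
    finally show ?thesis
      by simp
  qed
  show ?thesis
  proof
    assume inj: "inj_on (reduct \<beta>) K"
    show "\<alpha> + \<beta> \<noteq> 0"
      using inj_onD[OF inj, of 1 0] r[of 0] r[of 1] by auto
  next
    assume "\<alpha> + \<beta> \<noteq> 0"
    then show "inj_on (reduct \<beta>) K"
      by (intro inj_onI) (auto simp: r)
  qed
qed

text \<open>If \<alpha> lies in \<open>K\<close>, then \<alpha> + \<beta> is one of 0, 1, -1 and
  must be 1. Otherwise the sums are nonzero automatically, and \<alpha>^8 = 1 with \<alpha>^2
  different from 1 leaves the two power conditions.\<close>

lemma complete_q_3:
  assumes "\<beta> \<in> K" "q = 3"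
  shows "inj_on (reduct \<beta>) K \<and> inj_on (reduct (\<beta> + 1)) K \<longleftrightarrow>
    \<alpha> ^ 4 = - 1 \<or> \<alpha>\<^sup>2 = - 1 \<or> \<alpha> + \<beta> = 1"
proof -
  have three: "(3::'a) = 0"
    using of_nat_q assms(2) by simp
  have two: "(2::'a) \<noteq> 0"
    using three by (metis add_cancel_left_right numeral_Bit1 numeral_One one_add_one one_neq_zero)
  have R: "inj_on (reduct \<beta>) K \<and> inj_on (reduct (\<beta> + 1)) K \<longleftrightarrow> \<alpha> + \<beta> \<noteq> 0 \<and> \<alpha> + \<beta> + 1 \<noteq> 0"
    using inj_reduct_q_3[of \<beta>] inj_reduct_q_3[of "\<beta> + 1"] assms by (simp add: add.assoc)
  show ?thesis
  proof (cases "\<alpha> \<in> K")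
    case True
    have "\<alpha>\<^sup>2 = 1"
      using power_units[OF True \<alpha>_nz] assms(2) by simp
    then have sq: "\<alpha>\<^sup>2 \<noteq> - 1" "\<alpha> ^ 4 \<noteq> - 1"
      using two by (auto simp: eq_neg_iff_add_eq_0 power4_eq_xxxx power2_eq_square)
    obtain i where i: "i < 3" "\<alpha> + \<beta> = of_nat i"
      using prime_field[of "\<alpha> + \<beta>"] True assms by auto
    then have "i = 0 \<or> i = 1 \<or> i = 2"
      by linarith
    then show ?thesis
      unfolding R using sq i(2) two three by auto
  next
    case False
    have "\<alpha> + \<beta> \<noteq> 0" "\<alpha> + \<beta> + 1 \<noteq> 0"
    proof -
      have "\<alpha> = (\<alpha> + \<beta>) - \<beta>" "\<alpha> = (\<alpha> + \<beta> + 1) - \<beta> - 1"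
        by simp_all
      then show "\<alpha> + \<beta> \<noteq> 0" "\<alpha> + \<beta> + 1 \<noteq> 0"
        using False assms(1) by (metis diff_mem zero_mem one_mem)+
    qed
    moreover have "\<alpha> ^ 4 = - 1 \<or> \<alpha>\<^sup>2 = - 1"
    proof -
      have "(\<alpha>\<^sup>2 - 1) * ((\<alpha>\<^sup>2 + 1) * (\<alpha> ^ 4 + 1)) = \<alpha> ^ 8 - 1"
        by algebra
      also have "\<alpha> ^ 8 = 1"
        using whole.power_units[of \<alpha>] \<alpha>_nz assms(2) by simp
      finally have "\<alpha>\<^sup>2 = 1 \<or> \<alpha>\<^sup>2 + 1 = 0 \<or> \<alpha> ^ 4 + 1 = 0"
        by simp
      moreover have "\<alpha>\<^sup>2 \<noteq> 1"
        using False assms(2) unfolding u_eq_1_iff[symmetric] u_def by simp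
      ultimately show ?thesis
        by (auto simp: eq_neg_iff_add_eq_0)
    qed
    ultimately show ?thesis
      unfolding R by blast
  qed
qed

section \<open>The fields with 25 and 169 elements\<close>

lemma reduct_q_5:
  assumes "q = 5" "y \<in> K"
  shows "reduct \<beta> y = (nrm + \<beta>\<^sup>2) * y + trc * \<beta> * y ^ 3"
proof -
  have "y ^ 5 = y"
    using power_q[OF assms(2)] assms(1) by simp
  then show ?thesis
    unfolding reduct_def by (simp add: algebra_simps)
qed

text \<open>If both coefficients of c y + d y^3 are nonzero, then c is d, -d, 2d or -2d, and each
  possibility has an explicit collision.\<close>

lemma inj_reduct_q_5_imp:
  assumes "q = 5" "inj_on (reduct \<beta>) K" "\<beta> \<in> K"
  shows "trc * \<beta> = 0 \<or> nrm + \<beta>\<^sup>2 = 0"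
proof (rule ccontr)
  assume nz: "\<not> ?thesis"
  have five: "(5::'a) = 0"
    using of_nat_q assms(1) by simp
  define c where "c = nrm + \<beta>\<^sup>2"
  define d where "d = trc * \<beta>"
  have cd: "c \<in> K" "d \<in> K" "c \<noteq> 0" "d \<noteq> 0"
    using nz assms(3) by (simp_all add: c_def d_def)
  have r: "reduct \<beta> y = c * y + d * y ^ 3" if "y \<in> K" for y
    using reduct_q_5[OF assms(1) that] by (simp add: c_def d_def)
  have ne: "c * y + d * y ^ 3 \<noteq> c * z + d * z ^ 3" if "y \<in> K" "z \<in> K" "y \<noteq> z" for y z
    using inj_onD[OF assms(2)] that r by metis
  have "(c - d) * (c + d) * ((c - 2 * d) * (c + 2 * d)) = (c ^ 4 - d ^ 4) - 5 * (c\<^sup>2 * d\<^sup>2 - d ^ 4)"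
    by algebra
  moreover have "c ^ 4 = 1" "d ^ 4 = 1"
    using power_units cd assms(1) by force+
  ultimately have "(c - d) * (c + d) * ((c - 2 * d) * (c + 2 * d)) = 0"
    unfolding five by simp
  moreover have three: "(3::'a) \<noteq> 0" and two: "(2::'a) \<noteq> 0"
    using CHAR_if_prime assms(1) by (simp_all add: numeral_eq_0_iff_CHAR)
  ultimately consider "c - d = 0" | "c + d = 0" | "c - 2 * d = 0" | "c + 2 * d = 0"
    by auto
  then show False
  proof cases
    case 1
    have "c * 2 + d * 2 ^ 3 = 2 * (c - d) + 5 * (2 * d)"
      by algebra
    then show False
      using ne[of 2 0] two unfolding 1 five by simp
  next
    case 2
    have "c * 1 + d * 1 ^ 3 = c + d"
      by simp
    then show False
      using ne[of 1 0] unfolding 2 by simp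
  next
    case 3
    have "(3::'a) = 1 + 2"
      by simp
    then have "(3::'a) \<noteq> 1"
      using two by (metis add_cancel_left_right)
    then have "c * 3 + d * 3 ^ 3 \<noteq> c * 1 + d * 1 ^ 3"
      by (intro ne) simp_all
    moreover have "c * 3 + d * 3 ^ 3 = c + d + 2 * (c - 2 * d) + 5 * (6 * d)"
      by algebra
    then have "c * 3 + d * 3 ^ 3 = c * 1 + d * 1 ^ 3"
      unfolding 3 five by (simp only: mult_1_right power_one mult_zero_right mult_zero_left add_0_right)
    ultimately show False ..
  next
    case 4
    have "(1::'a) \<noteq> 2"
      by (metis add_cancel_right_right one_add_one zero_neq_one)
    then have "c * 2 + d * 2 ^ 3 \<noteq> c * 1 + d * 1 ^ 3"
      by (intro ne) simp_all
    moreover have "c * 2 + d * 2 ^ 3 = c + d + (c + 2 * d) + 5 * d"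
      by algebra
    then have "c * 2 + d * 2 ^ 3 = c * 1 + d * 1 ^ 3"
      unfolding 4 five by (simp only: mult_1_right power_one mult_zero_left add_0_right)
    ultimately show False ..
  qed
qed

text \<open>Only one of the monomials y and y^3 remains, and cubing is an involution on five
  elements.\<close>

lemma inj_reduct_q_5_if:
  assumes "q = 5" "trc * \<beta> = 0 \<and> nrm + \<beta>\<^sup>2 \<noteq> 0 \<or> trc * \<beta> \<noteq> 0 \<and> nrm + \<beta>\<^sup>2 = 0"
  shows "inj_on (reduct \<beta>) K"
proof (rule inj_onI)
  fix y z assume yz: "y \<in> K" "z \<in> K" "reduct \<beta> y = reduct \<beta> z"
  have cube: "(x ^ 3) ^ 3 = x" if "x \<in> K" for x
  proof -
    have x5: "x ^ 5 = x"
      using power_q[OF that] assms(1) by simp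
    have "(x ^ 3) ^ 3 = x ^ 5 * x ^ 4"
      by algebra
    also have "\<dots> = x * x ^ 4"
      by (simp only: x5)
    also have "\<dots> = x ^ 5"
      by algebra
    finally show ?thesis
      by (simp only: x5)
  qed
  from assms(2) show "y = z"
  proof
    assume "trc * \<beta> = 0 \<and> nrm + \<beta>\<^sup>2 \<noteq> 0"
    then show ?thesis
      using yz by (auto simp: reduct_q_5[OF assms(1)])
  next
    assume "trc * \<beta> \<noteq> 0 \<and> nrm + \<beta>\<^sup>2 = 0"
    then have "y ^ 3 = z ^ 3"
      using yz by (simp add: reduct_q_5[OF assms(1)])
    then show ?thesis
      using cube yz by metis
  qed
qed

lemma complete_q_5:
  assumes "\<beta> \<in> K" "q = 5"
  shows "inj_on (reduct \<beta>) K \<and> inj_on (reduct (\<beta> + 1)) K \<longleftrightarrow>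
    u = - 1 \<or> \<beta> ^ ((q - 1) div 2) \<in> {0, - (\<alpha> ^ ((q - 1) div 2))} \<and>
      (\<beta> + 1) ^ ((q - 1) div 2) \<in> {0, - (\<alpha> ^ ((q - 1) div 2))}
    \<or> \<alpha> ^ 4 - \<alpha>\<^sup>2 + 1 = 0 \<and> \<beta> \<in> {0, - 1}
    \<or> \<alpha> ^ 4 + \<alpha>\<^sup>2 + 1 = 0 \<and> \<beta> = 2"
    (is "?L \<longleftrightarrow> _ \<or> ?sq \<or> ?c6 \<or> ?c7")
proof -
  have five: "(5::'a) = 0"
    using of_nat_q assms(2) by simp
  have char: "CHAR('a) = 5"
    using CHAR_if_prime assms(2) by simp
  have nrm6: "nrm = \<alpha> ^ 6"
    unfolding nrm_def using assms(2) by simp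
  have u4: "u = \<alpha> ^ 4"
    unfolding u_def using assms(2) by simp
  have half: "(q - 1) div 2 = 2"
    using assms(2) by simp
  have minus_1: "\<alpha> ^ 6 = - 1 \<longleftrightarrow> \<alpha>\<^sup>2 = - 1 \<or> \<alpha> ^ 4 - \<alpha>\<^sup>2 + 1 = 0"
  proof -
    have "\<alpha> ^ 6 + 1 = (\<alpha>\<^sup>2 + 1) * (\<alpha> ^ 4 - \<alpha>\<^sup>2 + 1)"
      by algebra
    then show ?thesis
      by (metis eq_neg_iff_add_eq_0 mult_eq_0_iff)
  qed
  have plus_1: "\<alpha> ^ 6 = 1 \<longleftrightarrow> \<alpha>\<^sup>2 = 1 \<or> \<alpha> ^ 4 + \<alpha>\<^sup>2 + 1 = 0"
  proof -
    have "\<alpha> ^ 6 - 1 = (\<alpha>\<^sup>2 - 1) * (\<alpha> ^ 4 + \<alpha>\<^sup>2 + 1)"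
      by algebra
    then show ?thesis
      by (metis right_minus_eq mult_eq_0_iff)
  qed
  have four: "(4::'a) = - 1"
    using five by (simp add: eq_neg_iff_add_eq_0)
  have nine: "(9::'a) = - 1"
  proof -
    have "(9::'a) = 5 * 2 - 1"
      by simp
    then show ?thesis
      unfolding five by simp
  qed
  show ?thesis
  proof
    assume L: ?L
    show "u = - 1 \<or> ?sq \<or> ?c6 \<or> ?c7"
    proof (cases "u = - 1")
      case False
      then have "trc \<noteq> 0"
        using trc_eq_0_iff by simp
      then have 1: "\<beta> = 0 \<or> nrm + \<beta>\<^sup>2 = 0" and 2: "\<beta> + 1 = 0 \<or> nrm + (\<beta> + 1)\<^sup>2 = 0"
        using inj_reduct_q_5_imp[OF assms(2), of \<beta>] inj_reduct_q_5_imp[OF assms(2), of "\<beta> + 1"] L assms(1)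
        by auto
      consider "\<beta> = 0" | "\<beta> = - 1" | "nrm + \<beta>\<^sup>2 = 0" "nrm + (\<beta> + 1)\<^sup>2 = 0"
        using 1 2 by (auto simp: add_eq_0_iff2)
      then show ?thesis
      proof cases
        case b: 1
        then have "nrm + 1 = 0"
          using 2 by simp
        then have "\<alpha> ^ 6 = - 1"
          unfolding nrm6 by (simp add: eq_neg_iff_add_eq_0)
        then show ?thesis
          unfolding minus_1 half using b by auto
      next
        case b: 2
        then have "nrm + 1 = 0"
          using 1 by simp
        then have "\<alpha> ^ 6 = - 1"
          unfolding nrm6 by (simp add: eq_neg_iff_add_eq_0)
        then show ?thesis
          unfolding minus_1 half using b by auto
      next
        case 3
        \<comment> \<open>Subtracting the two conditions gives 2\<beta> + 1 = 0, and 3 is the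
          inverse of 2.\<close>
        have "\<beta> - 2 = 3 * ((nrm + (\<beta> + 1)\<^sup>2) - (nrm + \<beta>\<^sup>2)) - 5 * (\<beta> + 1)"
          by algebra
        then have b: "\<beta> = 2"
          unfolding 3 five by simp
        then have "nrm + 4 = 0"
          using 3(1) by simp
        then have "\<alpha> ^ 6 = 1"
          unfolding nrm6 four by simp
        then show ?thesis
          unfolding plus_1 half using b four nine by auto
      qed
    qed simp
  next
    assume "u = - 1 \<or> ?sq \<or> ?c6 \<or> ?c7"
    then consider "u = - 1" | ?sq | ?c6 | ?c7
      by blast
    then show ?L
    proof cases
      case 1
      then show ?thesis
        using inj_if_u_eq_minus_1[OF char] assms(1) add_mem[OF assms(1) one_mem] by blast
    next
      case 2
      then show ?thesis
        using complete_char_5_if[OF assms(1) char] by blast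
    next
      case 3
      have "\<alpha> ^ 4 \<noteq> - 1"
      proof
        assume "\<alpha> ^ 4 = - 1"
        moreover have "\<alpha>\<^sup>2 = (\<alpha> ^ 4 + 1) - (\<alpha> ^ 4 - \<alpha>\<^sup>2 + 1)"
          by simp
        ultimately show False
          using 3 \<alpha>_nz by simp
      qed
      then have "trc \<noteq> 0"
        using trc_eq_0_iff u4 by simp
      moreover have "nrm = - 1"
        unfolding nrm6 minus_1 using 3 by blast
      ultimately show ?thesis
        using 3 inj_reduct_q_5_if[OF assms(2), of 0] inj_reduct_q_5_if[OF assms(2), of 1]
          inj_reduct_q_5_if[OF assms(2), of "- 1"] by auto
    next
      case 4
      have "\<alpha> ^ 4 \<noteq> - 1"
        using 4 \<alpha>_nz by auto
      then have "trc \<noteq> 0"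
        using trc_eq_0_iff u4 by simp
      moreover have "nrm = 1"
        unfolding nrm6 plus_1 using 4 by blast
      moreover have "(2::'a) \<noteq> 0" "(3::'a) \<noteq> 0"
        using char by (simp_all add: numeral_eq_0_iff_CHAR)
      ultimately show ?thesis
        using 4 inj_reduct_q_5_if[OF assms(2), of 2] inj_reduct_q_5_if[OF assms(2), of 3] four nine by simp
    qed
  qed
qed

section \<open>The field with 169 elements\<close>

lemma of_nat_eq_13_iff:
  assumes "q = 13"
  shows "of_nat m = (of_nat n :: 'a) \<longleftrightarrow> m mod 13 = n mod 13"
  using CHAR_if_prime assms by (simp add: of_nat_eq_iff_cong_CHAR cong_def)

lemma reduct_q_13:
  assumes "q = 13" "2 * trc\<^sup>2 = 5 * nrm" "a = trc * \<beta> / nrm"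
  shows "reduct \<beta> y = nrm * (y ^ 5 + a * y ^ 3 + 3 * a\<^sup>2 * y)"
proof -
  have 13: "(13::'a) = 0"
    using of_nat_q assms(1) by simp
  have a: "trc * \<beta> = nrm * a"
    by (simp add: assms(3))
  have "nrm * (3 * a\<^sup>2 * nrm - \<beta>\<^sup>2) = 3 * (nrm * a)\<^sup>2 - nrm * \<beta>\<^sup>2"
    by algebra
  also have "\<dots> = 3 * \<beta>\<^sup>2 * trc\<^sup>2 - nrm * \<beta>\<^sup>2"
    unfolding a[symmetric] by algebra
  also have "\<dots> = 8 * \<beta>\<^sup>2 * (2 * trc\<^sup>2 - 5 * nrm) + 13 * (3 * \<beta>\<^sup>2 * nrm - \<beta>\<^sup>2 * trc\<^sup>2)"
    by algebra
  also have "\<dots> = 0"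
    unfolding assms(2) 13 by simp
  finally have "\<beta>\<^sup>2 = 3 * a\<^sup>2 * nrm"
    by simp
  then show ?thesis
    unfolding reduct_def a by algebra
qed

text \<open>Scaling y by c multiplies a by a square, so only the quadratic character of a =
  T\<beta>/N matters: one representative has a collision and the other is checked on all 13
  elements.\<close>

lemma inj_reduct_q_13_iff:
  assumes "q = 13" "2 * trc\<^sup>2 = 5 * nrm" "\<beta> \<in> K" "\<beta> \<noteq> 0" "trc \<noteq> 0"
  shows "inj_on (reduct \<beta>) K \<longleftrightarrow> (trc / nrm) ^ 6 * \<beta> ^ 6 = - 1"
proof -
  define a where "a = trc * \<beta> / nrm"
  have a: "a \<in> K" "a \<noteq> 0" "a ^ 6 = (trc / nrm) ^ 6 * \<beta> ^ 6"
    using assms(3-5) by (simp_all add: a_def power_mult_distrib power_divide)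
  note r = reduct_q_13[OF assms(1,2) a_def]
  have 13: "(13::'a) = 0"
    using of_nat_q assms(1) by simp
  have dvd: "2 dvd q - 1" "(q - 1) div 2 = 6"
    using assms(1) by simp_all
  have "a ^ 6 = 1 \<or> a ^ 6 = - 1"
    using square_or_minus_1[of 6 a] a assms(1) by simp
  then show ?thesis
    unfolding a(3)[symmetric]
  proof
    assume "a ^ 6 = 1"
    then obtain c where c: "c \<in> K" "c \<noteq> 0" "c\<^sup>2 = a"
      using ex_root[of 2 a] a dvd by auto
    have "\<not> inj_on (reduct \<beta>) K"
    proof
      assume inj: "inj_on (reduct \<beta>) K"
      \<comment> \<open>x^5 + x^3 + 3x takes the same value at 6 and 5 modulo 13.\<close>
      have "reduct \<beta> (c * 6) - reduct \<beta> (c * 5) = 13 * (365 * (nrm * c ^ 5))"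
        unfolding r c(3)[symmetric] by algebra
      then have "c * 6 = c * 5"
        using inj_onD[OF inj, of "c * 6" "c * 5"] c unfolding 13 by simp
      then show False
        using c(2) of_nat_eq_13_iff[OF assms(1), of 6 5] by simp
    qed
    moreover have "(2::'a) \<noteq> 0"
      using of_nat_eq_13_iff[OF assms(1), of 2 0] by simp
    then have "a ^ 6 \<noteq> - 1"
      using \<open>a ^ 6 = 1\<close> by auto
    ultimately show "inj_on (reduct \<beta>) K \<longleftrightarrow> a ^ 6 = - 1"
      by simp
  next
    assume a6: "a ^ 6 = - 1"
    \<comment> \<open>7 is the inverse of 2 modulo 13 and a nonsquare, so 7a is a square c^2 and a =
      2 c^2.\<close>
    have "(7 * a) ^ 6 = 1 - 13 * 9050"
      unfolding a6 power_mult_distrib by simp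
    then have "(7 * a) ^ 6 = 1"
      unfolding 13 by simp
    moreover have "7 * a \<in> K" "7 * a \<noteq> 0"
      using a of_nat_eq_13_iff[OF assms(1), of 7 0] by simp_all
    ultimately obtain c where c: "c \<in> K" "c \<noteq> 0" "c\<^sup>2 = 7 * a"
      using ex_root[of 2 "7 * a"] dvd by auto
    have "a = 2 * (7 * a) - 13 * a"
      by simp
    then have a2: "a = 2 * c\<^sup>2"
      unfolding 13 c(3) by simp
    have "[0..<13] = [0, 1, 2, 3, 4, 5, 6, 7, 8, 9, 10, 11, 12]"
      by (simp add: upt_rec)
    then have "distinct (map (\<lambda>i. (i ^ 5 + 2 * i ^ 3 + 12 * i) mod (13::nat)) [0..<13])"
      by simp
    then have check: "inj_on (\<lambda>i. (i ^ 5 + 2 * i ^ 3 + 12 * i) mod (13::nat)) {..<13}"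
      unfolding distinct_map by (simp add: atLeast0LessThan)
    have "inj_on (reduct \<beta>) K"
    proof (rule inj_onI)
      fix y z assume yz: "y \<in> K" "z \<in> K" "reduct \<beta> y = reduct \<beta> z"
      obtain i where i: "i < 13" "y / c = of_nat i"
        using prime_field[of "y / c"] assms(1) yz(1) c(1) by auto
      obtain j where j: "j < 13" "z / c = of_nat j"
        using prime_field[of "z / c"] assms(1) yz(2) c(1) by auto
      have yz': "y = c * of_nat i" "z = c * of_nat j"
        using i(2) j(2) c(2) by (simp_all add: field_simps)
      have val: "reduct \<beta> (c * x) = nrm * c ^ 5 * (x ^ 5 + 2 * x ^ 3 + 12 * x)" for x
        unfolding r a2 by algebra
      have "nrm * c ^ 5 * of_nat (i ^ 5 + 2 * i ^ 3 + 12 * i) = nrm * c ^ 5 * of_nat (j ^ 5 + 2 * j ^ 3 + 12 * j)"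
        using yz(3) unfolding yz' val by simp
      then have "of_nat (i ^ 5 + 2 * i ^ 3 + 12 * i) = (of_nat (j ^ 5 + 2 * j ^ 3 + 12 * j) :: 'a)"
        using c(2) by (simp only: mult_cancel_left) (simp del: of_nat_add of_nat_mult of_nat_power)
      then have "(i ^ 5 + 2 * i ^ 3 + 12 * i) mod 13 = (j ^ 5 + 2 * j ^ 3 + 12 * j) mod 13"
        unfolding of_nat_eq_13_iff[OF assms(1)] .
      then have "i = j"
        by (rule inj_onD[OF check]) (use i(1) j(1) in simp_all)
      then show "y = z"
        by (simp add: yz')
    qed
    then show "inj_on (reduct \<beta>) K \<longleftrightarrow> a ^ 6 = - 1"
      using a6 by simp
  qed
qed

lemma inj_reduct_0_q_13:
  assumes "q = 13"
  shows "inj_on (reduct 0) K"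
proof (rule inj_onI)
  fix y z assume yz: "y \<in> K" "z \<in> K" "reduct 0 y = reduct 0 z"
  then have "y ^ 5 = z ^ 5"
    by (simp add: reduct_def)
  moreover have "(x ^ 5) ^ 5 = x" if "x \<in> K" for x
  proof -
    have x13: "x ^ 13 = x"
      using power_q[OF that] assms by simp
    have "(x ^ 5) ^ 5 = x ^ 13 * x ^ 12"
      by algebra
    also have "\<dots> = x * x ^ 12"
      by (simp only: x13)
    also have "\<dots> = x ^ 13"
      by algebra
    finally show ?thesis
      by (simp only: x13)
  qed
  ultimately show "y = z"
    using yz by metis
qed

text \<open>The sixth power is the quadratic character modulo 13; these are the pairs of neighbours
  that are both squares (0 allowed) or both nonsquares (0 allowed).\<close>

lemma sixth_powers_q_13:
  assumes "q = 13" "\<beta> \<in> K"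
  shows "(\<beta> = 0 \<or> \<beta> ^ 6 = 1) \<and> (\<beta> + 1 = 0 \<or> (\<beta> + 1) ^ 6 = 1) \<longleftrightarrow> \<beta> \<in> {0, 3, - 4, - 1}"
    and "(\<beta> = 0 \<or> \<beta> ^ 6 = - 1) \<and> (\<beta> + 1 = 0 \<or> (\<beta> + 1) ^ 6 = - 1) \<longleftrightarrow> \<beta> \<in> {5, 6, 7}"
proof -
  note eq_iff = of_nat_eq_13_iff[OF assms(1)]
  have 13: "(13::'a) = 0"
    using of_nat_q assms(1) by simp
  have "- 4 = 9 - (13::'a)" "- 1 = 12 - (13::'a)"
    by simp_all
  then have neg: "- 4 = (9::'a)" "- 1 = (12::'a)"
    unfolding 13 by simp_all
  obtain i where i: "i < 13" "\<beta> = of_nat i"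
    using prime_field[OF _ assms(2)] assms(1) by auto
  have iff: "\<beta> = 0 \<longleftrightarrow> i mod 13 = 0" "\<beta> + 1 = 0 \<longleftrightarrow> (i + 1) mod 13 = 0"
    "\<beta> ^ 6 = 1 \<longleftrightarrow> i ^ 6 mod 13 = 1" "(\<beta> + 1) ^ 6 = 1 \<longleftrightarrow> (i + 1) ^ 6 mod 13 = 1"
    "\<beta> ^ 6 = 12 \<longleftrightarrow> i ^ 6 mod 13 = 12" "(\<beta> + 1) ^ 6 = 12 \<longleftrightarrow> (i + 1) ^ 6 mod 13 = 12"
    using eq_iff[of i 0] eq_iff[of "i + 1" 0] eq_iff[of "i ^ 6" 1] eq_iff[of "(i + 1) ^ 6" 1]
      eq_iff[of "i ^ 6" 12] eq_iff[of "(i + 1) ^ 6" 12] i(2) by (simp_all add: add.commute)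
  have mem: "\<beta> = 3 \<longleftrightarrow> i = 3" "\<beta> = 9 \<longleftrightarrow> i = 9" "\<beta> = 12 \<longleftrightarrow> i = 12" "\<beta> = 5 \<longleftrightarrow> i = 5" "\<beta> = 6 \<longleftrightarrow> i = 6" "\<beta> = 7 \<longleftrightarrow> i = 7"
    using eq_iff[of i 3] eq_iff[of i 9] eq_iff[of i 12] eq_iff[of i 5] eq_iff[of i 6] eq_iff[of i 7] i
    by simp_all
  have disj: "i = 0 \<or> i = 1 \<or> i = 2 \<or> i = 3 \<or> i = 4 \<or> i = 5 \<or> i = 6 \<or> i = 7 \<or> i = 8 \<or> i = 9
      \<or> i = 10 \<or> i = 11 \<or> i = 12"
    using i(1) by presburger
  have "(i mod 13 = 0 \<or> i ^ 6 mod 13 = 1) \<and> ((i + 1) mod 13 = 0 \<or> (i + 1) ^ 6 mod 13 = 1)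
      \<longleftrightarrow> i = 0 \<or> i = 3 \<or> i = 9 \<or> i = 12"
    using disj by (elim disjE) (simp_all flip: numeral_2_eq_2)
  then show "(\<beta> = 0 \<or> \<beta> ^ 6 = 1) \<and> (\<beta> + 1 = 0 \<or> (\<beta> + 1) ^ 6 = 1) \<longleftrightarrow> \<beta> \<in> {0, 3, - 4, - 1}"
    unfolding insert_iff empty_iff neg iff mem using i(1) by simp
  have "(i mod 13 = 0 \<or> i ^ 6 mod 13 = 12) \<and> ((i + 1) mod 13 = 0 \<or> (i + 1) ^ 6 mod 13 = 12)
      \<longleftrightarrow> i = 5 \<or> i = 6 \<or> i = 7"
    using disj by (elim disjE) (simp_all flip: numeral_2_eq_2)
  then show "(\<beta> = 0 \<or> \<beta> ^ 6 = - 1) \<and> (\<beta> + 1 = 0 \<or> (\<beta> + 1) ^ 6 = - 1) \<longleftrightarrow> \<beta> \<in> {5, 6, 7}"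
    unfolding insert_iff empty_iff neg iff mem by simp
qed

text \<open>The sign s treats the two sporadic conditions together. It fixes the quadratic character
  of T/N, hence whether \<beta> and \<beta> + 1, where nonzero, must be squares or
  nonsquares.\<close>

lemma trace_norm_ratio_q_13:
  assumes "q = 13" "s = 1 \<or> s = - 1" "(\<alpha> ^ 6)\<^sup>2 - 3 * s * \<alpha> ^ 6 + 1 = 0"
  shows "2 * trc\<^sup>2 = 5 * nrm" "(trc / nrm) ^ 6 = - s"
proof -
  have 13: "(13::'a) = 0"
    using of_nat_q assms(1) by simp
  define v where "v = \<alpha> ^ 6"
  have "v \<noteq> 0"
    using \<alpha>_nz by (simp add: v_def)
  have u: "u = v\<^sup>2"
    unfolding u_def v_def using assms(1) by (simp flip: power_mult)
  have v2: "v\<^sup>2 - 3 * s * v + 1 = 0"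
    using assms(3) by (simp add: v_def)
  have s2: "s\<^sup>2 = 1"
    using assms(2) by auto
  have "2 * (1 + u)\<^sup>2 - 5 * u = 2 * (v\<^sup>2 - 3 * s * v + 1) * (v\<^sup>2 + 3 * s * v + 1) + 13 * v\<^sup>2 + 18 * v\<^sup>2 * (s\<^sup>2 - 1)"
    unfolding u by algebra
  then show sq: "2 * trc\<^sup>2 = 5 * nrm"
    unfolding trc_sq_iff v2 s2 13 by simp
  have w2: "(s * v)\<^sup>2 - 3 * (s * v) + 1 = 0"
    using v2 s2 by (simp add: power_mult_distrib mult.assoc)
  \<comment> \<open>Division of X^7 + 1 by X^2 - 3X + 1; the remainder is divisible by 13.\<close>
  have "(s * v) ^ 7 + 1 = ((s * v)\<^sup>2 - 3 * (s * v) + 1) * ((s * v) ^ 5 + 3 * (s * v) ^ 4 + 8 * (s * v) ^ 3 + 21 * (s * v)\<^sup>2 + 55 * (s * v) + 144)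
      + 13 * (29 * (s * v) - 11)"
    by algebra
  then have "(s * v) ^ 7 = - 1"
    unfolding w2 13 by (simp add: eq_neg_iff_add_eq_0)
  then have v7: "v ^ 7 = - s"
    using assms(2) by auto
  have "1 + u = 3 * s * v"
    using v2 unfolding u by (simp add: algebra_simps)
  then have "trc * v\<^sup>2 * \<alpha> = nrm * (3 * s * v)"
    unfolding trc_eq nrm_eq u[symmetric] by (simp add: power2_eq_square)
  then have "trc / nrm * (v * \<alpha>) = 3 * s"
    using \<open>v \<noteq> 0\<close> by (simp add: field_simps power2_eq_square)
  then have "(3 * s) ^ 6 = (trc / nrm) ^ 6 * (v ^ 6 * \<alpha> ^ 6)"
    by (simp only: power_mult_distrib[symmetric])
  also have "v ^ 6 * \<alpha> ^ 6 = v ^ 6 * v"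
    by (simp only: v_def)
  also have "\<dots> = v ^ 7"
    by (simp add: eval_nat_numeral)
  finally have "(trc / nrm) ^ 6 * v ^ 7 = (3 * s) ^ 6" ..
  also have "\<dots> = 729"
    using assms(2) by auto
  also have "(729::'a) = 1 + 13 * 56"
    by simp
  also have "\<dots> = 1"
    unfolding 13 by simp
  finally show "(trc / nrm) ^ 6 = - s"
    unfolding v7 using assms(2) by (auto simp: minus_equation_iff)
qed

lemma complete_q_13:
  assumes "\<beta> \<in> K" "q = 13"
  shows "inj_on (reduct \<beta>) K \<and> inj_on (reduct (\<beta> + 1)) K \<longleftrightarrow>
    trc\<^sup>2 = 5 * nrm
    \<or> \<alpha> ^ 12 - 3 * \<alpha> ^ 6 + 1 = 0 \<and> \<beta> \<in> {0, 3, - 4, - 1}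
    \<or> \<alpha> ^ 12 + 3 * \<alpha> ^ 6 + 1 = 0 \<and> \<beta> \<in> {5, 6, 7}"
proof -
  have 13: "(13::'a) = 0"
    using of_nat_q assms(2) by simp
  have nz: "(2::'a) \<noteq> 0" "(5::'a) \<noteq> 0"
    using CHAR_if_prime assms(2) by (simp_all add: numeral_eq_0_iff_CHAR)
  have "\<alpha> ^ 12 = (\<alpha> ^ 6)\<^sup>2"
    by (simp flip: power_mult)
  then have minus: "\<alpha> ^ 12 - 3 * \<alpha> ^ 6 + 1 = 0 \<longleftrightarrow> (\<alpha> ^ 6)\<^sup>2 - 3 * 1 * \<alpha> ^ 6 + 1 = 0"
    and plus: "\<alpha> ^ 12 + 3 * \<alpha> ^ 6 + 1 = 0 \<longleftrightarrow> (\<alpha> ^ 6)\<^sup>2 - 3 * (- 1) * \<alpha> ^ 6 + 1 = 0"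
    by simp_all
  have R: "inj_on (reduct \<gamma>) K \<longleftrightarrow> \<gamma> = 0 \<or> (trc / nrm) ^ 6 * \<gamma> ^ 6 = - 1"
    if "2 * trc\<^sup>2 = 5 * nrm" "\<gamma> \<in> K" for \<gamma>
  proof -
    have "trc \<noteq> 0"
      using that(1) nz by auto
    then show ?thesis
      using inj_reduct_q_13_iff[OF assms(2) that] inj_reduct_0_q_13[OF assms(2)] by (cases "\<gamma> = 0") auto
  qed
  have case_minus: "inj_on (reduct \<beta>) K \<and> inj_on (reduct (\<beta> + 1)) K \<longleftrightarrow> \<beta> \<in> {0, 3, - 4, - 1}"
    if "\<alpha> ^ 12 - 3 * \<alpha> ^ 6 + 1 = 0"
  proof -
    note t = trace_norm_ratio_q_13[OF assms(2), of 1, OF _ that[unfolded minus]]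
    show ?thesis
      unfolding sixth_powers_q_13(1)[OF assms(2,1), symmetric] using t R assms(1) by simp
  qed
  have case_plus: "inj_on (reduct \<beta>) K \<and> inj_on (reduct (\<beta> + 1)) K \<longleftrightarrow> \<beta> \<in> {5, 6, 7}"
    if "\<alpha> ^ 12 + 3 * \<alpha> ^ 6 + 1 = 0"
  proof -
    note t = trace_norm_ratio_q_13[OF assms(2), of "- 1", OF _ that[unfolded plus]]
    show ?thesis
      unfolding sixth_powers_q_13(2)[OF assms(2,1), symmetric] using t R assms(1) by simp
  qed
  have split: "\<alpha> ^ 12 - 3 * \<alpha> ^ 6 + 1 = 0 \<or> \<alpha> ^ 12 + 3 * \<alpha> ^ 6 + 1 = 0" if "2 * trc\<^sup>2 = 5 * nrm"
  proof -
    have u: "u = \<alpha> ^ 12"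
      unfolding u_def using assms(2) by simp
    have "2 * (1 + u)\<^sup>2 = 5 * u"
      using that unfolding trc_sq_iff .
    \<comment> \<open>Modulo 13 the relation 2 T^2 = 5 N splits into exactly the two sporadic
      conditions.\<close>
    moreover have "2 * ((\<alpha> ^ 12 - 3 * \<alpha> ^ 6 + 1) * (\<alpha> ^ 12 + 3 * \<alpha> ^ 6 + 1)) = 2 * (1 + u)\<^sup>2 - 5 * u - 13 * u"
      unfolding u by algebra
    ultimately have "2 * ((\<alpha> ^ 12 - 3 * \<alpha> ^ 6 + 1) * (\<alpha> ^ 12 + 3 * \<alpha> ^ 6 + 1)) = 0"
      unfolding 13 by simp
    then show ?thesis
      using nz by simp
  qed
  have "trc\<^sup>2 = 5 * nrm \<or> 2 * trc\<^sup>2 = 5 * nrm" if "inj_on (reduct \<beta>) K \<and> inj_on (reduct (\<beta> + 1)) K"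
  proof -
    obtain \<gamma> where "\<gamma> \<in> {\<beta>, \<beta> + 1}" "\<gamma> \<noteq> 0"
      using one_nonzero by blast
    moreover from this have "inj_on (reduct \<gamma>) K" "\<gamma> \<in> K"
      using that assms(1) by auto
    ultimately show ?thesis
      using inj_reduct_imp[of \<gamma>] assms(2) by auto
  qed
  moreover have "inj_on (reduct \<beta>) K \<and> inj_on (reduct (\<beta> + 1)) K" if "trc\<^sup>2 = 5 * nrm"
    using inj_if_dickson[OF that nz(2)] assms(1) by simp
  ultimately show ?thesis
    using case_minus case_plus split by blast
qed

end

section \<open>Translation to polynomials and the final case distinction\<close>

lemma (in finite_subfield) ex_power_CHAR:
  assumes "primepow q"
  shows "\<exists>k. q = CHAR('a) ^ k"
proof -
  obtain p k where p: "prime p" "q = p ^ k"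
    using assms by (auto simp: primepow_def)
  have "CHAR('a) dvd p ^ k"
    using of_nat_q unfolding p(2) by (simp only: of_nat_eq_0_iff_char_dvd)
  then have "CHAR('a) dvd p"
    using prime_dvd_power CHAR_prime by blast
  then show ?thesis
    using p primes_dvd_imp_eq[of "CHAR('a)" p] by auto
qed

theorem corollary3p6:
  fixes Q :: nat and FQ :: "'a::finite_field set" and \<alpha> \<beta> :: 'a
  assumes "primepow Q"
    and "card (UNIV :: 'a set) = Q ^ 2"
    and "is_subfield FQ" and "card FQ = Q"
    and "\<alpha> \<noteq> 0" and "\<beta> \<in> FQ"
  shows "complete_permutation_poly (Polynomial.monom \<alpha> (2 * Q + 3) + Polynomial.monom \<beta> 1) \<longleftrightarrow>
      (([int Q = 2] (mod 5) \<or> [int Q = - 2] (mod 5)) \<and>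
         \<alpha> ^ (2 * Q - 2) - 3 * \<alpha> ^ (Q - 1) + 1 = 0)
    \<or> ((\<exists>n>0. Q = 5 ^ n) \<and> \<alpha> ^ (Q - 1) = - 1)
    \<or> ((\<exists>n>0. Q = 5 ^ n) \<and>
         \<beta> ^ ((Q - 1) div 2) \<in> {0, - (\<alpha> ^ ((Q - 1) div 2))} \<and>
         (\<beta> + 1) ^ ((Q - 1) div 2) \<in> {0, - (\<alpha> ^ ((Q - 1) div 2))})
    \<or> (Q = 13 \<and> \<alpha> ^ 12 - 3 * \<alpha> ^ 6 + 1 = 0 \<and> \<beta> \<in> {0, 3, - 4, - 1})
    \<or> (Q = 13 \<and> \<alpha> ^ 12 + 3 * \<alpha> ^ 6 + 1 = 0 \<and> \<beta> \<in> {5, 6, 7})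
    \<or> (Q = 5 \<and> \<alpha> ^ 4 - \<alpha> ^ 2 + 1 = 0 \<and> \<beta> \<in> {0, - 1})
    \<or> (Q = 5 \<and> \<alpha> ^ 4 + \<alpha> ^ 2 + 1 = 0 \<and> \<beta> = 2)
    \<or> (Q = 3 \<and> \<alpha> ^ 2 = - 1)
    \<or> (Q = 3 \<and> \<alpha> + \<beta> = 1)"
proof -
  have "finite_subfield FQ Q"
    by standard fact+
  then obtain k where k: "Q = CHAR('a) ^ k"
    using finite_subfield.ex_power_CHAR assms(1) by blast
  interpret quadratic_extension FQ Q \<alpha>
    by standard (use assms k in auto)
  have "poly (Polynomial.monom \<alpha> (2 * Q + 3) + Polynomial.monom \<beta> 1) = (\<lambda>x. \<alpha> * x ^ (2 * Q + 3) + \<beta> * x)"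
    by (auto simp: poly_monom)
  moreover have "poly (Polynomial.monom \<alpha> (2 * Q + 3) + Polynomial.monom \<beta> 1 + [:0, 1:]) =
      (\<lambda>x. \<alpha> * x ^ (2 * Q + 3) + (\<beta> + 1) * x)"
    by (auto simp: poly_monom algebra_simps)
  ultimately have lhs: "complete_permutation_poly (Polynomial.monom \<alpha> (2 * Q + 3) + Polynomial.monom \<beta> 1) \<longleftrightarrow>
      inj_on (reduct \<beta>) FQ \<and> inj_on (reduct (\<beta> + 1)) FQ"
    unfolding complete_permutation_poly_def permutation_poly_def
    using permutation_iff[OF assms(6)] permutation_iff[OF add_mem[OF assms(6) one_mem]] by simp
  have cong: "[int Q = 2] (mod 5) \<or> [int Q = - 2] (mod 5) \<longleftrightarrow> Q mod 5 = 2 \<or> Q mod 5 = 3"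
  proof -
    have "int Q mod 5 = int (Q mod 5)"
      by (simp add: zmod_int)
    then show ?thesis
      unfolding cong_def by auto
  qed
  have pow: "(\<exists>n>0. Q = 5 ^ n) \<longleftrightarrow> Q mod 5 = 0"
  proof
    assume "Q mod 5 = 0"
    then have "CHAR('a) = 5"
      by (rule CHAR_eq_5)
    then have Q: "Q = 5 ^ k"
      unfolding k by (simp only:)
    moreover have "k \<noteq> 0"
      using q_ge_2 unfolding Q by (rule contrapos_pn) simp
    ultimately show "\<exists>n>0. Q = 5 ^ n"
      by blast
  qed auto
  have "Q mod 5 = 0 \<or> Q mod 5 = 1 \<or> Q mod 5 = 2 \<or> Q mod 5 = 3 \<or> Q mod 5 = 4"
    by presburger
  then consider "Q = 3" | "Q = 5" | "Q = 13" | "Q mod 5 = 1 \<or> Q mod 5 = 4"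
    | "Q mod 5 = 2 \<or> Q mod 5 = 3" "Q \<noteq> 3" "Q \<noteq> 13" | "Q mod 5 = 0" "Q \<noteq> 5"
    by metis
  then show ?thesis
  proof cases
    case 1
    then have three_eq_0: "(3::'a) = 0"
      using of_nat_q by simp
    show ?thesis
    proof -
      \<comment> \<open>In characteristic 3 the middle term drops out, so the general condition
        supplies the missing case \<alpha>^4 = -1.\<close>
      have "\<alpha> ^ (2 * Q - 2) - 3 * \<alpha> ^ (Q - 1) + 1 = 0 \<longleftrightarrow> \<alpha> ^ 4 = - 1"
        using 1 three_eq_0 by (simp add: eq_neg_iff_add_eq_0)
      then show ?thesis
        unfolding lhs cong pow complete_q_3[OF assms(6) 1] using 1 by auto
    qed
  next
    case 2
    then show ?thesis
      unfolding lhs cong pow complete_q_5[OF assms(6) 2] u_def by simp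
  next
    case 3
    then show ?thesis
      unfolding lhs cong pow complete_q_13[OF assms(6) 3] dickson_iff by simp
  next
    case 4
    then have "Q \<noteq> 3" "Q \<noteq> 5" "Q \<noteq> 13"
      by auto
    then show ?thesis
      unfolding lhs cong pow using complete_mod_5_1_4[OF assms(6) 4] 4 by auto
  next
    case 5
    then have "Q mod 5 \<noteq> 0" "Q \<noteq> 5"
      by auto
    then show ?thesis
      unfolding lhs cong pow complete_mod_5_2_3[OF assms(6) 5] dickson_iff using 5 by simp
  next
    case 6
    then have "Q \<noteq> 3" "Q \<noteq> 13"
      by auto
    then show ?thesis
      unfolding lhs cong pow complete_char_5[OF assms(6) CHAR_eq_5[OF 6(1)] 6(2)] u_def using 6 by simp
  qed
qed

end
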